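(* The map $\hat F$ is conjugate to the full shift $\sigma$ on $\{1,\dots,7\}^{\mathbb{Z}}$ by the symbolic coding $\mathscr{C}$, i.e. $$\mathscr{C}(\hat F(u,v))=\sigma(\mathscr{C}(u,v)).$$
   Context: Matrices: $$\gamma=\begin{pmatrix}-1&2(1+\sqrt2)\\0&1\end{pmatrix},\quad \nu_0=\begin{pmatrix}1&0\\0&1\end{pmatrix},\ \nu_1=\tfrac1{\sqrt2}\begin{pmatrix}1&1\\1&-1\end{pmatrix},\ \nu_2=\tfrac1{\sqrt2}\begin{pmatrix}1&1\\-1&1\end{pmatrix},\ \nu_3=\begin{pmatrix}0&1\\1&0\end{pmatrix},$$ $$\nu_4=\begin{pmatrix}0&1\\-1&0\end{pmatrix},\ \nu_5=\tfrac1{\sqrt2}\begin{pmatrix}-1&1\\1&1\end{pmatrix},\ \nu_6=\tfrac1{\sqrt2}\begin{pmatrix}-1&1\\-1&-1\end{pmatrix},\ \nu_7=\begin{pmatrix}-1&0\\0&1\end{pmatrix}.$$ Points of $\mathbb{RP}^1$ are given by the inverse slope coordinate $u=x/y\in\mathbb{R}\cup\{\infty\}$ or the angle $\theta\in[0,\pi]$, $u=\cot\theta$. A matrix $L=\begin{pmatrix}a&b\\c&d\end{pmatrix}$ acts by $L[u]=\frac{au+b}{cu+d}$. $\Sigma_i$ is the sector with angles $[i\pi/8,(i+1)\pi/8)$, $0\le i\le7$, $\overline\Sigma_i$ is the corresponding closed sector, and $\Sigma=\Sigma_1\cup\dots\cup\Sigma_7$. Octagon Farey map: $F(u)=F_i(u)=\gamma\nu_i[u]$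 for $u\in\overline\Sigma_i$; here it is restricted to $\Sigma$ (so $1\le i\le7$). The map $\hat F$: $\hat F(u,v)=(\gamma\nu_i[u],\gamma\nu_i[v])$ for $(u,v)\in\Sigma\times\Sigma_0$ with $u\in\Sigma_i$, $1\le i\le7$. Forward expansion: $u=[s_0;s_1,s_2,\dots]_O$ (octagon additive continued fraction expansion of $u$) means that $u$ is the unique point of $\bigcap_{k}F_{s_0}^{-1}F_{s_1}^{-1}\cdots F_{s_k}^{-1}[0,\pi]$ (angle coordinates); for $u\in\Sigma$ the entries are taken in $\{1,\dots,7\}$. Backward expansion: the sectors $\Sigma_i'=\gamma\nu_i\Sigma_0$, $1\le i\le7$, give a partition of $\Sigma_0$, and $F^-(v)=\nu_i^{-1}\gamma[v]$ for $v\in\Sigma_i'$, with branches $(F^-)_i$. One writes $v=[s_{-1},s_{-2},\dots]_O^-$ when $(F^-)^{k-1}(v)\in\Sigma'_{s_{-k}}$ for each $k\ge1$, equivalently $v\in\bigcap_{k\ge1}(F^-)^{-1}_{s_{-1}}\cdots(F^-)^{-1}_{s_{-k}}\Sigma_0$. Symbolic coding: $\mathscr{C}:\Sigma\times\Sigma_0\to\{1,\dots,7\}^{\mathbb{Z}}$, $\mathscr{C}(u,v)=\{s_i\}_{i\in\mathbb{Z}}$, where $u=[s_0;s_1,\dots]_O$ and $v=[s_{-1},s_{-2},\dots]_O^-$. The full shift is $\sigma(\{s_i\}_{i\in\mathbb{Z}})=\{s_i'\}_{i\in\mathbb{Z}}$ with $s_i'=s_{i+1}$.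
   Formalization: At sector endpoints codes may be non-unique or missing, and F̂ may leave Σ×Σ₀. The equation is stated for codes with u in Σ_{s_0}, and for C where the code is unique at both points; bijectivity holds off exceptional orbits, onto sequences with no constant 1- or 7-tail in either direction. *)

theory Defs
  imports "HOL-Analysis.Analysis"
begin

text \<open>Points of the real projective line, in the inverse slope coordinate \<open>u = x/y\<close>.\<close>

datatype rp1 = Fin real | Infty

definition inv_slope :: "real \<Rightarrow> rp1" where
  "inv_slope \<theta> = (if sin \<theta> = 0 then Infty else Fin (cot \<theta>))"

definition mat2 :: "real \<Rightarrow> real \<Rightarrow> real \<Rightarrow> real \<Rightarrow> real^2^2" where
  "mat2 a b c d = vector [vector [a, b], vector [c, d]]"

text \<open>The action \<open>L[u] = (a u + b) / (c u + d)\<close> on \<open>\<real> \<union> {\<infinity>}\<close>; it is used only for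
  invertible \<open>L\<close>.\<close>

fun moebius :: "real^2^2 \<Rightarrow> rp1 \<Rightarrow> rp1" where
  "moebius L (Fin u) =
     (if L$2$1 * u + L$2$2 = 0 then Infty
      else Fin ((L$1$1 * u + L$1$2) / (L$2$1 * u + L$2$2)))"
| "moebius L Infty = (if L$2$1 = 0 then Infty else Fin (L$1$1 / L$2$1))"

definition gam :: "real^2^2" where
  "gam = mat2 (-1) (2 * (1 + sqrt 2)) 0 1"

definition nu :: "nat \<Rightarrow> real^2^2" where
  "nu i =
    [mat2 1 0 0 1,
     (1 / sqrt 2) *\<^sub>R mat2 1 1 1 (-1),
     (1 / sqrt 2) *\<^sub>R mat2 1 1 (-1) 1,
     mat2 0 1 1 0,
     mat2 0 1 (-1) 0,
     (1 / sqrt 2) *\<^sub>R mat2 (-1) 1 1 1,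
     (1 / sqrt 2) *\<^sub>R mat2 (-1) 1 (-1) (-1),
     mat2 (-1) 0 0 1] ! i"

text \<open>Sectors. The angles \<open>0\<close> and \<open>\<pi>\<close> are the same point \<open>Infty\<close>; it lies in the half-open
  sector \<open>0\<close> and in the closed sectors \<open>0\<close> and \<open>7\<close>.\<close>

definition sector :: "nat \<Rightarrow> rp1 set" where
  "sector i = inv_slope ` {real i * pi / 8 ..< real (i + 1) * pi / 8}"

definition closed_sector :: "nat \<Rightarrow> rp1 set" where
  "closed_sector i = inv_slope ` {real i * pi / 8 .. real (i + 1) * pi / 8}"

definition Sigma_plus :: "rp1 set" where
  "Sigma_plus = (\<Union>i\<in>{1..7}. sector i)"

definition branch :: "nat \<Rightarrow> rp1 \<Rightarrow> rp1" where
  "branch i u = moebius (gam ** nu i) u"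

definition sector_index :: "rp1 \<Rightarrow> nat" where
  "sector_index u = (THE i. i \<in> {1..7} \<and> u \<in> sector i)"

text \<open>The map \<open>(u, v) \<mapsto> (\<gamma>\<nu>\<^sub>i[u], \<gamma>\<nu>\<^sub>i[v])\<close> where \<open>u\<close> lies in sector \<open>i\<close>. It is meant
  on \<open>Sigma_plus \<times> sector 0\<close>. The left endpoints of the sectors \<open>2, 4, 6\<close> are sent to the angle
  \<open>\<pi>\<close>, which is not in \<open>Sigma_plus\<close>, so the map does not quite preserve that set.\<close>

definition F_hat :: "rp1 \<times> rp1 \<Rightarrow> rp1 \<times> rp1" where
  "F_hat = (\<lambda>(u, v). (branch (sector_index u) u, branch (sector_index u) v))"

text \<open>The preimage under the branch \<open>F\<^sub>i\<close>, whose domain is the closed sector \<open>i\<close>, and the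
  forward expansion \<open>u = [s\<^sub>0; s\<^sub>1, \<dots>]\<^sub>O\<close> with entries in \<open>{1..7}\<close>; the angle
  interval \<open>[0, \<pi>]\<close> is the whole projective line.\<close>

definition branch_preimage :: "nat \<Rightarrow> rp1 set \<Rightarrow> rp1 set" where
  "branch_preimage i A = {u \<in> closed_sector i. branch i u \<in> A}"

definition forward_expansion :: "rp1 \<Rightarrow> (nat \<Rightarrow> nat) \<Rightarrow> bool" where
  "forward_expansion u s \<longleftrightarrow>
     range s \<subseteq> {1..7} \<and>
     (\<Inter>k. foldr branch_preimage (map s [0..<Suc k]) UNIV) = {u}"

text \<open>The sectors \<open>\<Sigma>\<^sub>i' = \<gamma>\<nu>\<^sub>i\<Sigma>\<^sub>0\<close> and the branches \<open>\<nu>\<^sub>i\<^sup>-\<^sup>1\<gamma>\<close> of \<open>F\<^sup>-\<close>. Since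
  \<open>\<nu>\<^sub>i\<close> reverses orientation for odd \<open>i\<close>, the half-open sectors \<open>\<Sigma>\<^sub>i'\<close> partition sector \<open>0\<close>
  only up to endpoints: some endpoints lie in two of them and some in none. The expansion is
  therefore stated through the branches, as membership of \<open>v\<close> in
  \<open>(F\<^sup>-)\<^sub>s\<^sub>1\<^sup>-\<^sup>1 \<dots> (F\<^sup>-)\<^sub>s\<^sub>k\<^sup>-\<^sup>1 \<Sigma>\<^sub>0\<close> for every \<open>k \<ge> 1\<close>. The entry written \<open>s\<^sub>-\<^sub>k\<close> in
  \<open>[s\<^sub>-\<^sub>1, s\<^sub>-\<^sub>2, \<dots>]\<close> is the entry \<open>k - 1\<close> of \<open>t\<close>.\<close>

definition back_sector :: "nat \<Rightarrow> rp1 set" where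
  "back_sector i = branch i ` sector 0"

definition back_branch :: "nat \<Rightarrow> rp1 \<Rightarrow> rp1" where
  "back_branch i v = moebius (matrix_inv (nu i) ** gam) v"

definition back_preimage :: "nat \<Rightarrow> rp1 set \<Rightarrow> rp1 set" where
  "back_preimage i A = {v \<in> back_sector i. back_branch i v \<in> A}"

definition backward_expansion :: "rp1 \<Rightarrow> (nat \<Rightarrow> nat) \<Rightarrow> bool" where
  "backward_expansion v t \<longleftrightarrow>
     range t \<subseteq> {1..7} \<and>
     v \<in> (\<Inter>k. foldr back_preimage (map t [0..<Suc k]) (sector 0))"

text \<open>A pair may have several codes, or none, because of sector endpoints. The map \<open>coding\<close> is
  meaningful on \<open>coding_domain\<close>, where the code exists and is unique.\<close>

definition is_code :: "rp1 \<times> rp1 \<Rightarrow> (int \<Rightarrow> nat) \<Rightarrow> bool" where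
  "is_code = (\<lambda>(u, v) s.
     forward_expansion u (\<lambda>n. s (int n)) \<and> backward_expansion v (\<lambda>n. s (- 1 - int n)))"

definition coding_domain :: "(rp1 \<times> rp1) set" where
  "coding_domain = {x \<in> Sigma_plus \<times> sector 0. \<exists>!s. is_code x s}"

definition coding :: "rp1 \<times> rp1 \<Rightarrow> int \<Rightarrow> nat" where
  "coding x = (THE s. is_code x s)"

definition full_shift_space :: "(int \<Rightarrow> nat) set" where
  "full_shift_space = {s. range s \<subseteq> {1..7}}"

definition shift :: "(int \<Rightarrow> nat) \<Rightarrow> int \<Rightarrow> nat" where
  "shift s = (\<lambda>i. s (i + 1))"

text \<open>The countable sets of exceptional points: those reaching one of the two endpoints
  \<open>0 = \<pi>\<close> and \<open>\<pi>/8\<close> of \<open>Sigma_plus\<close> (equivalently of sector \<open>0\<close>) under iteration of the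
  branches of \<open>F\<close>, respectively of \<open>F\<^sup>-\<close>. Each endpoint of a sector \<open>1, \<dots>, 7\<close> is mapped to one
  of these two by \<open>F\<close>, so all sector endpoints are included.\<close>

inductive_set forward_exceptional :: "rp1 set" where
  "inv_slope 0 \<in> forward_exceptional"
| "inv_slope (pi / 8) \<in> forward_exceptional"
| "i \<in> {1..7} \<Longrightarrow> branch i u \<in> forward_exceptional \<Longrightarrow> u \<in> forward_exceptional"

inductive_set backward_exceptional :: "rp1 set" where
  "inv_slope 0 \<in> backward_exceptional"
| "inv_slope (pi / 8) \<in> backward_exceptional"
| "i \<in> {1..7} \<Longrightarrow> v \<in> backward_exceptional \<Longrightarrow> branch i v \<in> backward_exceptional"

definition regular_pairs :: "(rp1 \<times> rp1) set" where
  "regular_pairs =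
     (Sigma_plus - forward_exceptional) \<times> (sector 0 - backward_exceptional)"

text \<open>The symbolic counterpart: the constant tails \<open>1, 1, \<dots>\<close> and \<open>7, 7, \<dots>\<close> expand the two
  endpoints \<open>\<pi>/8\<close> and \<open>\<pi>\<close>.\<close>

definition regular_sequences :: "(int \<Rightarrow> nat) set" where
  "regular_sequences =
     {s \<in> full_shift_space. \<forall>a\<in>{1, 7}.
        \<not> (\<exists>n. \<forall>i\<ge>n. s i = a) \<and> \<not> (\<exists>n. \<forall>i\<le>n. s i = a)}"

end

theory Submission
  imports Defs
begin

text \<open>The proof reduces to one-sided symbolic dynamics of the branches. The point \<open>\<infinity>\<close> and the point
  \<open>cot (\<pi>/8) = 1 + \<surd>2\<close>, called cusps here, cut the projective line into two arcs. Write
  \<open>inner_arc\<close> for the interior of sector \<open>0\<close>. The branch \<open>\<gamma>\<nu>\<^sub>i\<close> maps closed sector \<open>i\<close> onto the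
  complement of \<open>inner_arc\<close> and the rest of the line into \<open>inner_arc\<close>
  (\<open>closed_sector_iff\<close>). Hence lying in closed sector \<open>i\<close> means that the branch \<open>i\<close> does not enter
  \<open>inner_arc\<close>, and a forward expansion of \<open>u\<close> is a sequence of branches along which \<open>u\<close>
  never enters \<open>inner_arc\<close>; such a sequence is called an itinerary of \<open>u\<close>.

  A sequence is an itinerary of at most one point. For \<open>u \<noteq> w\<close> at angle \<open>\<alpha>\<close>, consider
  \<open>\<bar>cot \<alpha>\<bar>\<close>. The matrices \<open>\<nu>\<^sub>i\<close> are orthogonal and preserve it, and \<open>\<gamma>\<close> lowers it by at
  least \<open>2 (1 + \<surd>2)\<close> as long as the images again share a sector
  (\<open>cot_gap_flip\<close>). The quantity is nonnegative, so two points cannot share a sector forever. The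
  bound is additive rather than multiplicative because the cusps are parabolic fixed points of the
  branches \<open>7\<close> and \<open>1\<close>, at which no uniform contraction exists. Every sequence with entries in
  \<open>{1..7}\<close> is an itinerary of some point, by compactness of the unit circle (\<open>ex_itinerary_point\<close>).

  Two of the closed sectors \<open>1, \<dots>, 7\<close> meet at most in a common endpoint, and both branches
  send it to the same cusp (\<open>branch_overlap\<close>). As \<open>inner_arc\<close> is invariant under all branches, a word of branches that sends
  \<open>u\<close> to a cusp can never have entered \<open>inner_arc\<close>; it is therefore the beginning of an itinerary.
  So the exceptional points are exactly those whose itineraries end in the expansion of a cusp,
  that is in \<open>1, 1, \<dots>\<close> or \<open>7, 7, \<dots>\<close> (\<open>forward_exceptional_iff_parabolic_tail\<close>), and every other
  point has exactly one itinerary.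

  The backward expansion is the forward expansion in disguise. Up to scalars, the inverses of the
  \<open>\<nu>\<^sub>i\<close> are again the \<open>\<nu>\<^sub>i\<close>, with the rotations \<open>\<nu>\<^sub>2\<close> and \<open>\<nu>\<^sub>6\<close> exchanged, so that
  \<open>\<nu>\<^sub>i\<^sup>-\<^sup>1\<gamma> = \<gamma> (\<gamma>\<nu>\<^sub>j) \<gamma>\<close> with \<open>j = dual i\<close> (\<open>back_branch_eq\<close>): the involution \<open>\<gamma>\<close>, called
  \<open>flip\<close>, carries backward expansions of \<open>v\<close> to itineraries of \<open>\<gamma>[v]\<close>. Applying the one-sided
  theory to \<open>u\<close> and to \<open>\<gamma>[v]\<close> makes the coding a bijection on regular pairs. It intertwines
  \<open>F_hat\<close> with the shift since applying the branch \<open>s 0\<close> deletes the first entry of the forward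
  expansion of \<open>u\<close> and prepends it to the backward expansion of \<open>v\<close>. Bijectivity of \<open>F_hat\<close> on
  regular pairs is then inherited from the shift.\<close>

section \<open>Arcs, cusps and homogeneous coordinates\<close>

definition cusp :: real where
  "cusp = 1 + sqrt 2"

definition inner_arc :: "rp1 set" where
  "inner_arc = {Fin u |u. u > cusp}"

definition cusps :: "rp1 set" where
  "cusps = {Infty, Fin cusp}"

definition proj :: "real^2 \<Rightarrow> rp1" where
  "proj x = (if x$2 = 0 then Infty else Fin (x$1 / x$2))"

lemma Fin_in_inner_arc [simp]: "Fin u \<in> inner_arc \<longleftrightarrow> u > cusp"
  by (simp add: inner_arc_def)

lemma Infty_notin_inner_arc [simp]: "Infty \<notin> inner_arc"
  by (simp add: inner_arc_def)

lemma cusp_pos: "cusp > 0"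
  by (simp add: cusp_def add_pos_pos)

lemma mat2_nth [simp]:
  "mat2 a b c d $ 1 $ 1 = a" "mat2 a b c d $ 1 $ 2 = b"
  "mat2 a b c d $ 2 $ 1 = c" "mat2 a b c d $ 2 $ 2 = d"
  by (simp_all add: mat2_def)

lemma index_cases:
  assumes "i \<in> {1..7::nat}"
  obtains "i = 1" | "i = 2" | "i = 3" | "i = 4" | "i = 5" | "i = 6" | "i = 7"
  using assms by (auto simp: numeral_eq_Suc le_Suc_eq)

lemma proj_surj:
  obtains x where "x \<noteq> 0" "proj x = u"
proof (cases u)
  case (Fin a)
  show ?thesis
    by (rule that[of "vector [a, 1]"]) (auto simp: Fin proj_def vec_eq_iff forall_2)
next
  case Infty
  show ?thesis
    by (rule that[of "vector [1, 0]"]) (auto simp: Infty proj_def vec_eq_iff forall_2)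
qed

text \<open>Homogeneous coordinates make the action linear: composition of Moebius maps, their effect on
  angles and the continuity needed for compactness become statements on matrices.\<close>

lemma proj_matrix_vector:
  assumes "x \<noteq> 0"
  shows "proj (A *v x) = moebius A (proj x)"
proof (cases "x$2 = 0")
  case True
  with assms have "x$1 \<noteq> 0" by (auto simp: vec_eq_iff forall_2)
  with True show ?thesis by (simp add: proj_def matrix_vector_mult_def sum_2)
next
  case False
  then have "A$2$1 * (x$1 / x$2) + A$2$2 = (A$2$1 * x$1 + A$2$2 * x$2) / x$2"
    "A$1$1 * (x$1 / x$2) + A$1$2 = (A$1$1 * x$1 + A$1$2 * x$2) / x$2"
    by (simp_all add: field_simps)
  with False show ?thesis
    by (simp add: proj_def matrix_vector_mult_def sum_2)
qed

text \<open>Avoiding the arc is the sign condition on a quadratic form, and so visibly a closed condition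
  on the vector, as the compactness argument needs.\<close>

lemma proj_notin_inner_arc:
  "proj x \<notin> inner_arc \<longleftrightarrow> x$2 * (x$1 - cusp * x$2) \<le> 0"
proof (cases "x$2 = 0")
  case False
  have "x$2 * (x$1 - cusp * x$2) = (x$2)\<^sup>2 * (x$1 / x$2 - cusp)"
    using False by (simp add: power2_eq_square right_diff_distrib)
  moreover have "(x$2)\<^sup>2 * d \<le> 0 \<longleftrightarrow> d \<le> 0" for d
    using False by (simp add: mult_le_0_iff)
  ultimately show ?thesis
    using False by (simp only: proj_def Fin_in_inner_arc) auto
qed (simp add: proj_def)

lemma matrix_vector_nonzero:
  fixes A :: "real^2^2"
  assumes "invertible A" "x \<noteq> 0"
  shows "A *v x \<noteq> 0"
  using assms by (metis invertible_def matrix_left_invertible_ker)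

lemma moebius_mult:
  assumes "invertible B"
  shows "moebius (A ** B) u = moebius A (moebius B u)"
proof -
  obtain x where x: "x \<noteq> 0" "proj x = u" by (rule proj_surj)
  have "moebius (A ** B) u = proj (A *v (B *v x))"
    using proj_matrix_vector[OF x(1), of "A ** B"] x(2) by (simp add: matrix_vector_mul_assoc)
  also have "\<dots> = moebius A (moebius B u)"
    using x matrix_vector_nonzero[OF assms x(1)] by (simp add: proj_matrix_vector)
  finally show ?thesis .
qed

lemma moebius_scaleR:
  assumes "r \<noteq> 0"
  shows "moebius (r *\<^sub>R A) u = moebius A u"
proof -
  have "(r * a * x + r * b = 0) = (a * x + b = 0)"
    "(r * a * x + r * b) / (r * c * x + r * d) = (a * x + b) / (c * x + d)" for a b c d x
    using assms by (simp_all add: mult.assoc flip: distrib_left)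
  then show ?thesis using assms by (cases u) (simp_all)
qed

lemma moebius_one: "moebius (mat 1) u = u"
  by (cases u) (simp_all add: mat_def)

section \<open>The involution and the dihedral matrices\<close>

definition flip :: "rp1 \<Rightarrow> rp1" where
  "flip = moebius gam"

lemma flip_Fin [simp]: "flip (Fin u) = Fin (2 * cusp - u)"
  by (simp add: flip_def gam_def cusp_def)

lemma flip_Infty [simp]: "flip Infty = Infty"
  by (simp add: flip_def gam_def)

lemma flip_flip [simp]: "flip (flip u) = u"
  by (cases u) simp_all

text \<open>\<open>\<gamma>\<close> is a reflection that fixes the two cusps, hence exchanges the two open
  arcs between them.\<close>

lemma flip_in_inner_arc: "flip u \<in> inner_arc \<longleftrightarrow> u \<notin> inner_arc \<and> u \<notin> cusps"
  by (cases u) (auto simp: cusps_def)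

lemma invertible_gam: "invertible gam"
  by (simp add: invertible_det_nz det_2 gam_def)

lemma nu_simps:
  "nu (Suc 0) = (1 / sqrt 2) *\<^sub>R mat2 1 1 1 (-1)"
  "nu 2 = (1 / sqrt 2) *\<^sub>R mat2 1 1 (-1) 1"
  "nu 3 = mat2 0 1 1 0"
  "nu 4 = mat2 0 1 (-1) 0"
  "nu 5 = (1 / sqrt 2) *\<^sub>R mat2 (-1) 1 1 1"
  "nu 6 = (1 / sqrt 2) *\<^sub>R mat2 (-1) 1 (-1) (-1)"
  "nu 7 = mat2 (-1) 0 0 1"
  by (simp_all add: nu_def numeral_eq_Suc)

lemma orthogonal_nu:
  assumes "i \<in> {1..7}"
  shows "orthogonal_matrix (nu i)"
  using assms
  by (cases rule: index_cases)
     (simp_all add: nu_simps orthogonal_matrix matrix_matrix_mult_def transpose_def mat_def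
       vec_eq_iff forall_2 sum_2)

lemma invertible_nu: "i \<in> {1..7} \<Longrightarrow> invertible (nu i)"
  using orthogonal_nu by (auto simp: orthogonal_matrix_def invertible_def)

lemma branch_eq: "i \<in> {1..7} \<Longrightarrow> branch i u = flip (moebius (nu i) u)"
  unfolding branch_def flip_def by (rule moebius_mult) (rule invertible_nu)

lemma invertible_branch: "i \<in> {1..7} \<Longrightarrow> invertible (gam ** nu i)"
  by (simp add: invertible_gam invertible_nu invertible_mult)

text \<open>The index of the inverse: \<open>\<nu>\<^sub>2\<close> and \<open>\<nu>\<^sub>6\<close> are
  rotations inverse to each other up to sign, the other matrices are involutions of the
  projective line.\<close>

definition dual :: "nat \<Rightarrow> nat" where
  "dual i = (if i = 2 then 6 else if i = 6 then 2 else i)"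

lemma dual_dual [simp]: "dual (dual i) = i"
  by (simp add: dual_def)

lemma dual_range [simp]: "dual i \<in> {1..7} \<longleftrightarrow> i \<in> {1..7}"
  by (auto simp: dual_def)

lemma dual_bounds [simp]: "Suc 0 \<le> dual i \<longleftrightarrow> Suc 0 \<le> i" "dual i \<le> 7 \<longleftrightarrow> i \<le> 7"
  by (auto simp: dual_def)

lemma inverse_nu:
  assumes "i \<in> {1..7}"
  obtains r where "r \<noteq> 0" "matrix_inv (nu i) = r *\<^sub>R nu (dual i)"
proof -
  \<comment> \<open>The matrices \<open>\<nu>\<^sub>4\<^sup>2\<close> and \<open>\<nu>\<^sub>2 \<nu>\<^sub>6\<close> are minus the identity.\<close>
  define r :: real where "r = (if i \<in> {2, 4, 6} then -1 else 1)"
  have "nu i ** (r *\<^sub>R nu (dual i)) = mat 1 \<and> (r *\<^sub>R nu (dual i)) ** nu i = mat 1"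
    using assms
    by (cases rule: index_cases)
       (simp_all add: nu_simps dual_def r_def matrix_matrix_mult_def mat_def
         vec_eq_iff forall_2 sum_2)
  moreover from this have "nu i ** matrix_inv (nu i) = mat 1 \<and> matrix_inv (nu i) ** nu i = mat 1"
    unfolding matrix_inv_def by (rule someI)
  ultimately have "matrix_inv (nu i) = r *\<^sub>R nu (dual i)"
    by (metis matrix_mul_assoc matrix_mul_lid matrix_mul_rid)
  then show thesis by (intro that[of r]) (auto simp: r_def)
qed

text \<open>This conjugacy turns every statement on backward expansions into one on itineraries. It holds
  because \<open>\<gamma>\<close> is an involution: \<open>\<nu>\<^sub>j \<gamma> = \<gamma>
  (\<gamma> \<nu>\<^sub>j) \<gamma>\<close>.\<close>

lemma back_branch_eq:
  assumes "i \<in> {1..7}"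
  shows "back_branch i v = flip (branch (dual i) (flip v))"
proof -
  obtain r where r: "r \<noteq> 0" "matrix_inv (nu i) = r *\<^sub>R nu (dual i)"
    using inverse_nu[OF assms] .
  show ?thesis
    using assms
    by (simp only: back_branch_def moebius_mult[OF invertible_gam] r(2) moebius_scaleR[OF r(1)]
        branch_eq dual_range flip_flip flip_def[symmetric])
qed

lemma back_branch_branch:
  assumes "i \<in> {1..7}"
  shows "back_branch i (branch i u) = u" "branch i (back_branch i u) = u"
proof -
  have "nu i ** matrix_inv (nu i) = mat 1 \<and> matrix_inv (nu i) ** nu i = mat 1"
    using invertible_nu[OF assms] unfolding invertible_def matrix_inv_def by (rule someI_ex)
  then have inv: "matrix_inv (nu i) ** nu i = mat 1" "nu i ** matrix_inv (nu i) = mat 1"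
    by simp_all
  have i: "invertible (matrix_inv (nu i))"
    using inv by (auto simp: invertible_def)
  show "back_branch i (branch i u) = u"
    using assms moebius_mult[OF invertible_nu[OF assms], of "matrix_inv (nu i)" u]
    by (simp add: back_branch_def branch_eq moebius_mult[OF invertible_gam]
        flip_def[symmetric] inv moebius_one)
  show "branch i (back_branch i u) = u"
    using assms moebius_mult[OF i, of "nu i" "flip u"]
    by (simp add: back_branch_def branch_eq moebius_mult[OF invertible_gam]
        flip_def[symmetric] inv moebius_one)
qed

section \<open>Sectors in the inverse slope coordinate\<close>

text \<open>\<open>bound i\<close> is \<open>cot (i \<pi> / 8)\<close> for \<open>1 \<le> i \<le>
  7\<close>. The cotangent is infinite at angle \<open>0\<close>, so the entry of index
  \<open>0\<close> is only a placeholder.\<close>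

definition bound :: "nat \<Rightarrow> real" where
  "bound i = [0, 1 + sqrt 2, 1, sqrt 2 - 1, 0, 1 - sqrt 2, - 1, - 1 - sqrt 2] ! i"

lemma bound_simps [simp]:
  "bound (Suc 0) = 1 + sqrt 2" "bound (Suc (Suc 0)) = 1" "bound 2 = 1" "bound 3 = sqrt 2 - 1" "bound 4 = 0"
  "bound 5 = 1 - sqrt 2" "bound 6 = - 1" "bound 7 = - 1 - sqrt 2"
  by (simp_all add: bound_def numeral_eq_Suc)

lemma arctan_bounds: "arctan (sqrt 2 - 1) = pi / 8" "arctan (1 + sqrt 2) = 3 * pi / 8"
proof -
  have s: "sqrt 2 < (2::real)" by (rule real_less_lsqrt) auto
  have "2 * arctan (sqrt 2 - 1) = arctan (2 * (sqrt 2 - 1) / (1 - (sqrt 2 - 1)\<^sup>2))"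
    using s by (intro arctan_double) (auto simp: abs_less_iff)
  also have "2 * (sqrt 2 - 1) / (1 - (sqrt 2 - 1)\<^sup>2) = (1::real)"
  proof -
    have "1 - (sqrt 2 - 1)\<^sup>2 = 2 * (sqrt 2 - (1::real))"
      by (simp add: power2_eq_square algebra_simps)
    then show ?thesis by (simp only:) simp
  qed
  finally show *: "arctan (sqrt 2 - 1) = pi / 8" by (simp add: arctan_one)
  have "1 + sqrt 2 = 1 / (sqrt 2 - (1::real))" by (simp add: field_simps)
  moreover have "arctan (1 / (sqrt 2 - 1)) = sgn (sqrt 2 - 1) * pi / 2 - arctan (sqrt 2 - 1)"
    using arctan_inverse[of "sqrt 2 - 1"] by (simp add: inverse_eq_divide)
  ultimately show "arctan (1 + sqrt 2) = 3 * pi / 8" using * by simp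
qed

lemma arctan_bound:
  assumes "i \<in> {1..7}"
  shows "arctan (bound i) = (4 - real i) * pi / 8"
proof -
  have n: "arctan (1 - sqrt 2) = - (pi / 8)" "arctan (- 1 - sqrt 2) = - (3 * pi / 8)"
    using arctan_minus[of "sqrt 2 - 1"] arctan_minus[of "1 + sqrt 2"] by (simp_all add: arctan_bounds)
  from assms show ?thesis
    by (cases rule: index_cases) (simp_all add: n arctan_bounds arctan_one arctan_minus)
qed

text \<open>The angle of a finite point is \<open>\<pi>/2 - arctan u\<close>; monotonicity of
  \<open>arctan\<close> then turns angle intervals into intervals of inverse slopes, traversed
  in the opposite direction.\<close>

lemma inv_slope_eq_Fin:
  assumes "0 \<le> \<theta>" "\<theta> \<le> pi"
  shows "inv_slope \<theta> = Fin u \<longleftrightarrow> \<theta> = pi / 2 - arctan u"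
proof (cases "0 < \<theta> \<and> \<theta> < pi")
  case True
  then have "sin \<theta> \<noteq> 0" using sin_gt_zero by force
  moreover have "cot \<theta> = tan (pi / 2 - \<theta>)" by (simp add: tan_cot')
  moreover have "tan (pi / 2 - \<theta>) = u \<longleftrightarrow> pi / 2 - \<theta> = arctan u"
    using True arctan_tan[of "pi / 2 - \<theta>"] tan_arctan[of u] by auto
  ultimately show ?thesis by (auto simp: inv_slope_def)
next
  case False
  with assms have "\<theta> = 0 \<or> \<theta> = pi" by auto
  with arctan_bounded[of u] show ?thesis by (auto simp: inv_slope_def)
qed

lemma inv_slope_eq_Infty:
  assumes "0 \<le> \<theta>" "\<theta> \<le> pi"
  shows "inv_slope \<theta> = Infty \<longleftrightarrow> \<theta> = 0 \<or> \<theta> = pi"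
  using assms sin_gt_zero[of \<theta>] by (cases "\<theta> = 0 \<or> \<theta> = pi") (auto simp: inv_slope_def)

lemma Fin_in_inv_slope_image:
  assumes "A \<subseteq> {0..pi}"
  shows "Fin u \<in> inv_slope ` A \<longleftrightarrow> pi / 2 - arctan u \<in> A"
proof -
  have "Fin u = inv_slope \<theta> \<longleftrightarrow> \<theta> = pi / 2 - arctan u" if "\<theta> \<in> A" for \<theta>
    using inv_slope_eq_Fin[of \<theta> u] that assms by auto
  then show ?thesis by (auto simp: image_iff)
qed

lemma Infty_in_inv_slope_image:
  assumes "A \<subseteq> {0..pi}"
  shows "Infty \<in> inv_slope ` A \<longleftrightarrow> 0 \<in> A \<or> pi \<in> A"
proof -
  have "Infty = inv_slope \<theta> \<longleftrightarrow> \<theta> = 0 \<or> \<theta> = pi" if "\<theta> \<in> A" for \<theta>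
    using inv_slope_eq_Infty[of \<theta>] that assms by auto
  then show ?thesis by (auto simp: image_iff)
qed

lemma inv_slope_ends: "inv_slope 0 = Infty" "inv_slope (pi / 8) = Fin cusp"
proof -
  show "inv_slope 0 = Infty" by (simp add: inv_slope_def)
  show "inv_slope (pi / 8) = Fin cusp"
    by (subst inv_slope_eq_Fin) (auto simp: cusp_def arctan_bounds)
qed

lemma sector_angles:
  assumes "i \<le> 7"
  shows "{real i * pi / 8 ..< real (i + 1) * pi / 8} \<subseteq> {0..pi}"
    "{real i * pi / 8 .. real (i + 1) * pi / 8} \<subseteq> {0..pi}"
proof -
  have "real (i + 1) * pi \<le> 8 * pi" using assms by (intro mult_right_mono) auto
  then have "real (i + 1) * pi / 8 \<le> pi" by linarith
  moreover have "0 \<le> real i * pi / 8" by simp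
  ultimately show "{real i * pi / 8 .. real (i + 1) * pi / 8} \<subseteq> {0..pi}"
    by (meson atLeastatMost_subset_iff)
  moreover have "{a..<b} \<subseteq> {a..b}" for a b :: real by auto
  ultimately show "{real i * pi / 8 ..< real (i + 1) * pi / 8} \<subseteq> {0..pi}"
    by blast
qed

lemma arctan_le_bound:
  assumes "i \<in> {1..7}"
  shows "real i * pi / 8 \<le> pi / 2 - arctan u \<longleftrightarrow> u \<le> bound i"
    "pi / 2 - arctan u \<le> real i * pi / 8 \<longleftrightarrow> bound i \<le> u"
proof -
  have e: "real i * pi / 8 = pi / 2 - arctan (bound i)"
    unfolding arctan_bound[OF assms] by (simp add: algebra_simps diff_divide_distrib)
  show "real i * pi / 8 \<le> pi / 2 - arctan u \<longleftrightarrow> u \<le> bound i"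
    unfolding e arctan_le_iff[of u, symmetric] by linarith
  show "pi / 2 - arctan u \<le> real i * pi / 8 \<longleftrightarrow> bound i \<le> u"
    unfolding e arctan_le_iff[of _ u, symmetric] by linarith
qed

lemma sector_0: "sector 0 = insert Infty inner_arc"
proof (rule set_eqI)
  fix u show "u \<in> sector 0 \<longleftrightarrow> u \<in> insert Infty inner_arc"
  proof (cases u)
    case (Fin a)
    have "0 \<le> pi / 2 - arctan a" using arctan_ubound[of a] by simp
    then show ?thesis
      using arctan_le_bound(1)[of 1 a] sector_angles(1)[of 0]
      by (auto simp: Fin sector_def Fin_in_inv_slope_image cusp_def)
  qed (use sector_angles(1)[of 0] in \<open>auto simp: sector_def Infty_in_inv_slope_image\<close>)
qed

lemma Fin_in_sector:
  assumes "i \<in> {1..7}"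
  shows "Fin u \<in> sector i \<longleftrightarrow> u \<le> bound i \<and> (i < 7 \<longrightarrow> bound (i + 1) < u)"
    "Fin u \<in> closed_sector i \<longleftrightarrow> u \<le> bound i \<and> (i < 7 \<longrightarrow> bound (i + 1) \<le> u)"
proof -
  define \<theta> where "\<theta> = pi / 2 - arctan u"
  have i: "i \<le> 7" using assms by simp
  have left: "real i * pi / 8 \<le> \<theta> \<longleftrightarrow> u \<le> bound i"
    using arctan_le_bound(1)[OF assms] by (simp add: \<theta>_def)
  have right: "(\<theta> < real (i + 1) * pi / 8 \<longleftrightarrow> (i < 7 \<longrightarrow> bound (i + 1) < u)) \<and>
    (\<theta> \<le> real (i + 1) * pi / 8 \<longleftrightarrow> (i < 7 \<longrightarrow> bound (i + 1) \<le> u))"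
  proof (cases "i = 7")
    case True
    then show ?thesis using arctan_lbound[of u] by (simp add: \<theta>_def)
  next
    case False
    with i have j: "i + 1 \<in> {1..7}" "i < 7" by auto
    show ?thesis
      using arctan_le_bound[OF j(1), of u] j(2) unfolding \<theta>_def by linarith
  qed
  show "Fin u \<in> sector i \<longleftrightarrow> u \<le> bound i \<and> (i < 7 \<longrightarrow> bound (i + 1) < u)"
    unfolding sector_def Fin_in_inv_slope_image[OF sector_angles(1)[OF i]]
    using left right by (simp add: \<theta>_def)
  show "Fin u \<in> closed_sector i \<longleftrightarrow> u \<le> bound i \<and> (i < 7 \<longrightarrow> bound (i + 1) \<le> u)"
    unfolding closed_sector_def Fin_in_inv_slope_image[OF sector_angles(2)[OF i]]
    using left right by (simp add: \<theta>_def)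
qed

lemma Infty_in_sector:
  assumes "i \<in> {1..7}"
  shows "Infty \<notin> sector i" "Infty \<in> closed_sector i \<longleftrightarrow> i = 7"
proof -
  have i: "i \<le> 7" using assms by simp
  have pos: "real i * pi > 0" using assms by simp
  have top: "real (i + 1) * pi < 8 * pi \<or> i = 7"
    using i by (cases "i = 7") auto
  show "Infty \<notin> sector i"
    unfolding sector_def Infty_in_inv_slope_image[OF sector_angles(1)[OF i]]
    using pos top by (auto simp: not_le not_less)
  show "Infty \<in> closed_sector i \<longleftrightarrow> i = 7"
    unfolding closed_sector_def Infty_in_inv_slope_image[OF sector_angles(2)[OF i]]
    using pos top by (auto simp: not_le not_less)
qed

section \<open>Branches and closed sectors\<close>

lemma flip_moebius_mat2_notin_inner_arc:
  "flip (moebius (mat2 p q r s) (Fin a)) \<notin> inner_arc \<longleftrightarrow>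
     0 \<le> (r * a + s) * (p * a + q - cusp * (r * a + s))"
proof (cases "r * a + s = 0")
  case False
  have "(p * a + q) / (r * a + s) = cusp + (p * a + q - cusp * (r * a + s)) / (r * a + s)"
    using False by (simp add: diff_divide_distrib)
  moreover have "0 \<le> n / (r * a + s) \<longleftrightarrow> 0 \<le> (r * a + s) * n" for n
    by (auto simp: zero_le_divide_iff zero_le_mult_iff)
  ultimately show ?thesis using False by (simp add: not_less)
qed simp

lemma quadratic_nonneg_between:
  fixes a :: real
  assumes "k > 0" "lo < hi"
  shows "0 \<le> k * ((a - lo) * (hi - a)) \<longleftrightarrow> a \<le> hi \<and> lo \<le> a"
  using assms by (auto simp: zero_le_mult_iff)

lemma bound_strict_antimono:
  assumes "i \<in> {1..7}" "j \<in> {1..7}" "i < j"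
  shows "bound j < bound i"
proof -
  have "(4 - real j) * pi < (4 - real i) * pi" using assms by simp
  then have "arctan (bound j) < arctan (bound i)"
    unfolding arctan_bound[OF assms(1)] arctan_bound[OF assms(2)] by linarith
  then show ?thesis by (simp add: arctan_less_iff)
qed

lemma bound_antimono:
  assumes "i \<in> {1..7}" "j \<in> {1..7}" "i \<le> j"
  shows "bound j \<le> bound i"
  using bound_strict_antimono[of i j] assms by (cases "i = j") auto

text \<open>For a fixed matrix, the sign condition above is a quadratic inequality in \<open>a\<close>;
  its two roots \<open>lo\<close> and \<open>hi\<close> turn out to be the endpoints of the
  sector.\<close>

lemma branch_notin_inner_arc_between:
  assumes "i \<in> {1..7}" "moebius (nu i) (Fin a) = moebius (mat2 p q r s) (Fin a)"
    and "(r * a + s) * (p * a + q - cusp * (r * a + s)) = k * ((a - lo) * (hi - a))"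
    and "k > 0" "lo < hi"
  shows "branch i (Fin a) \<notin> inner_arc \<longleftrightarrow> a \<le> hi \<and> lo \<le> a"
  using assms quadratic_nonneg_between[of k lo hi a] flip_moebius_mat2_notin_inner_arc[of p q r s a]
  by (simp only: branch_eq)

text \<open>This holds because \<open>\<nu>\<^sub>i\<close> maps closed sector \<open>i\<close> onto
  closed sector \<open>0\<close>. It replaces all references to angles in the sequel: which
  branch may be applied is decided by where it leads.\<close>

lemma closed_sector_iff:
  assumes "i \<in> {1..7}"
  shows "u \<in> closed_sector i \<longleftrightarrow> branch i u \<notin> inner_arc"
proof (cases u)
  case (Fin a)
  obtain t :: real where t: "sqrt 2 = t" "t * t = 2" "\<And>x. t * (t * x) = 2 * x" "1 < t" "t < 2"
    by (rule that[of "sqrt 2"]) (simp_all add: real_less_lsqrt flip: mult.assoc)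
  have "branch i u \<notin> inner_arc \<longleftrightarrow> a \<le> bound i \<and> (i < 7 \<longrightarrow> bound (i + 1) \<le> a)"
    using assms
  proof (cases rule: index_cases)
    case 1
    have "branch 1 (Fin a) \<notin> inner_arc \<longleftrightarrow> a \<le> 1 + t \<and> 1 \<le> a"
    proof (rule branch_notin_inner_arc_between[where k = "t"])
      show "moebius (nu 1) (Fin a) = moebius (mat2 1 1 1 (-1)) (Fin a)"
        by (simp add: nu_simps moebius_scaleR del: moebius.simps)
    qed (use t in \<open>auto simp: cusp_def algebra_simps\<close>)
    then show ?thesis by (simp add: 1 Fin t(1))
  next
    case 2
    have "branch 2 (Fin a) \<notin> inner_arc \<longleftrightarrow> a \<le> 1 \<and> t - 1 \<le> a"
    proof (rule branch_notin_inner_arc_between[where k = "2 + t"])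
      show "moebius (nu 2) (Fin a) = moebius (mat2 1 1 (-1) 1) (Fin a)"
        by (simp add: nu_simps moebius_scaleR del: moebius.simps)
    qed (use t in \<open>auto simp: cusp_def algebra_simps\<close>)
    then show ?thesis by (simp add: 2 Fin t(1))
  next
    case 3
    have "branch 3 (Fin a) \<notin> inner_arc \<longleftrightarrow> a \<le> t - 1 \<and> 0 \<le> a"
    proof (rule branch_notin_inner_arc_between[where k = "1 + t"])
      show "moebius (nu 3) (Fin a) = moebius (mat2 0 1 1 0) (Fin a)"
        by (simp add: nu_simps moebius_scaleR del: moebius.simps)
    qed (use t in \<open>auto simp: cusp_def algebra_simps\<close>)
    then show ?thesis by (simp add: 3 Fin t(1))
  next
    case 4
    have "branch 4 (Fin a) \<notin> inner_arc \<longleftrightarrow> a \<le> 0 \<and> 1 - t \<le> a"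
    proof (rule branch_notin_inner_arc_between[where k = "1 + t"])
      show "moebius (nu 4) (Fin a) = moebius (mat2 0 1 (-1) 0) (Fin a)"
        by (simp add: nu_simps moebius_scaleR del: moebius.simps)
    qed (use t in \<open>auto simp: cusp_def algebra_simps\<close>)
    then show ?thesis by (simp add: 4 Fin t(1))
  next
    case 5
    have "branch 5 (Fin a) \<notin> inner_arc \<longleftrightarrow> a \<le> 1 - t \<and> -1 \<le> a"
    proof (rule branch_notin_inner_arc_between[where k = "2 + t"])
      show "moebius (nu 5) (Fin a) = moebius (mat2 (-1) 1 1 1) (Fin a)"
        by (simp add: nu_simps moebius_scaleR del: moebius.simps)
    qed (use t in \<open>auto simp: cusp_def algebra_simps\<close>)
    then show ?thesis by (simp add: 5 Fin t(1))
  next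
    case 6
    have "branch 6 (Fin a) \<notin> inner_arc \<longleftrightarrow> a \<le> -1 \<and> -1 - t \<le> a"
    proof (rule branch_notin_inner_arc_between[where k = "t"])
      show "moebius (nu 6) (Fin a) = moebius (mat2 (-1) 1 (-1) (-1)) (Fin a)"
        by (simp add: nu_simps moebius_scaleR del: moebius.simps)
    qed (use t in \<open>auto simp: cusp_def algebra_simps\<close>)
    then show ?thesis by (simp add: 6 Fin t(1))
  next
    case 7
    show ?thesis
      by (simp add: branch_eq 7 Fin nu_simps flip_moebius_mat2_notin_inner_arc del: moebius.simps) (auto simp: cusp_def)
  qed
  then show ?thesis by (simp add: Fin Fin_in_sector(2)[OF assms])
next
  case Infty
  have c: "1 < cusp" by (simp add: cusp_def)
  have "branch i u \<notin> inner_arc \<longleftrightarrow> i = 7"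
    using assms
    by (cases rule: index_cases) (use c in \<open>simp_all add: Infty branch_eq nu_simps\<close>)
  then show ?thesis by (simp add: Infty Infty_in_sector(2)[OF assms])
qed

text \<open>Neighbouring branches have the same image but opposite orientations, so they agree at their
  common endpoint, and the endpoints are sent to the two cusps alternately.\<close>

lemma branch_bound:
  assumes "i \<in> {1..7}"
  shows "branch i (Fin (bound i)) = (if even i then Infty else Fin cusp)"
    "i < 7 \<Longrightarrow> branch i (Fin (bound (i + 1))) = (if even i then Fin cusp else Infty)"
    "branch 7 Infty = Infty"
proof -
  let ?r = "sqrt 2 :: real"
  have s: "?r > 1" "?r < 2" by (simp_all add: real_less_lsqrt)
  have cusp: "moebius (mat2 p q r s) (Fin a) = Fin cusp"
    if "r * a + s \<noteq> 0" "p * a + q = cusp * (r * a + s)" for p q r s a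
    using that by simp
  show "branch i (Fin (bound i)) = (if even i then Infty else Fin cusp)"
    using assms
  proof (cases rule: index_cases)
    case 1
    have "moebius (mat2 1 1 1 (-1)) (Fin (1 + ?r)) = Fin cusp"
      by (rule cusp) (use s in \<open>auto simp: cusp_def algebra_simps\<close>)
    then show ?thesis by (simp add: 1 branch_eq nu_simps moebius_scaleR del: moebius.simps)
  next
    case 3
    have "moebius (mat2 0 1 1 0) (Fin (?r - 1)) = Fin cusp"
      by (rule cusp) (use s in \<open>auto simp: cusp_def algebra_simps\<close>)
    then show ?thesis by (simp add: 3 branch_eq nu_simps del: moebius.simps)
  next
    case 5
    have "moebius (mat2 (-1) 1 1 1) (Fin (1 - ?r)) = Fin cusp"
      by (rule cusp) (use s in \<open>auto simp: cusp_def algebra_simps\<close>)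
    then show ?thesis by (simp add: 5 branch_eq nu_simps moebius_scaleR del: moebius.simps)
  next
    case 7
    then show ?thesis by (simp add: branch_eq nu_simps cusp_def)
  qed (simp_all add: branch_eq nu_simps moebius_scaleR)
  show "branch i (Fin (bound (i + 1))) = (if even i then Fin cusp else Infty)" if "i < 7"
    using assms
  proof (cases rule: index_cases)
    case 2
    have "moebius (mat2 1 1 (-1) 1) (Fin (?r - 1)) = Fin cusp"
      by (rule cusp) (use s in \<open>auto simp: cusp_def algebra_simps\<close>)
    then show ?thesis by (simp add: 2 branch_eq nu_simps moebius_scaleR del: moebius.simps)
  next
    case 4
    have "moebius (mat2 0 1 (-1) 0) (Fin (1 - ?r)) = Fin cusp"
      by (rule cusp) (use s in \<open>auto simp: cusp_def algebra_simps\<close>)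
    then show ?thesis by (simp add: 4 branch_eq nu_simps del: moebius.simps)
  next
    case 6
    have "moebius (mat2 (-1) 1 (-1) (-1)) (Fin (- 1 - ?r)) = Fin cusp"
      by (rule cusp) (use s in \<open>auto simp: cusp_def algebra_simps\<close>)
    then show ?thesis by (simp add: 6 branch_eq nu_simps moebius_scaleR del: moebius.simps)
  qed (use that in \<open>simp_all add: branch_eq nu_simps moebius_scaleR\<close>)
  show "branch 7 Infty = Infty" by (simp add: branch_eq nu_simps)
qed

text \<open>The only ambiguity in choosing a branch is at a common endpoint of two neighbouring sectors,
  where the choice does not affect the image.\<close>

lemma branch_overlap:
  assumes ij: "i \<in> {1..7}" "j \<in> {1..7}" "i \<noteq> j"
    and u: "branch i u \<notin> inner_arc" "branch j u \<notin> inner_arc"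
  shows "branch i u = branch j u" "branch i u \<in> cusps"
proof -
  have main: "branch i u = branch j u \<and> branch i u \<in> cusps"
    if ij: "i \<in> {1..7}" "j \<in> {1..7}" "i < j" and u: "u \<in> closed_sector i" "u \<in> closed_sector j"
    for i j
  proof (cases u)
    case (Fin a)
    have a: "bound (i + 1) \<le> a" "a \<le> bound j"
      using u ij by (auto simp: Fin Fin_in_sector(2))
    have i1: "i + 1 \<in> {1..7}" using ij by auto
    have j: "j = i + 1"
      using bound_strict_antimono[OF i1 ij(2)] a ij(3) by fastforce
    with a have "a = bound (i + 1)" by simp
    then show ?thesis
      using branch_bound(2)[OF ij(1)] branch_bound(1)[OF i1] ij
      by (auto simp: Fin j cusps_def)
  next
    case Infty
    then show ?thesis using u ij by (simp add: Infty_in_sector(2))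
  qed
  have "u \<in> closed_sector i" "u \<in> closed_sector j"
    using u ij by (simp_all add: closed_sector_iff)
  with main[of i j] main[of j i] ij(1,2,3)
  have "branch i u = branch j u \<and> branch i u \<in> cusps"
    by (metis linorder_neqE_nat)
  then show "branch i u = branch j u" "branch i u \<in> cusps" by blast+
qed

text \<open>A point in \<open>inner_arc\<close> lies in none of the closed sectors \<open>1, \<dots>,
  7\<close>. Consequently an orbit that enters \<open>inner_arc\<close> never leaves it again.\<close>

lemma branch_inner_arc:
  assumes "i \<in> {1..7}" "u \<in> inner_arc"
  shows "branch i u \<in> inner_arc"
proof -
  obtain a where a: "u = Fin a" "a > cusp" using assms(2) by (auto simp: inner_arc_def)
  have "bound i \<le> cusp" using bound_antimono[of 1 i] assms(1) by (simp add: cusp_def)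
  then have "u \<notin> closed_sector i" using a by (simp add: Fin_in_sector(2)[OF assms(1)])
  then show ?thesis using closed_sector_iff[OF assms(1)] by blast
qed

text \<open>At each cusp only one branch is available, and it fixes the cusp.\<close>

lemma branch_cusp:
  assumes "i \<in> {1..7}" "u \<in> cusps" "branch i u \<notin> inner_arc"
  shows "branch i u = u" "i = (if u = Infty then 7 else 1)"
proof -
  have "u \<in> closed_sector i" using assms closed_sector_iff by blast
  have *: "i = (if u = Infty then 7 else 1)"
  proof (cases "u = Infty")
    case False
    then have "cusp \<le> bound i"
      using assms \<open>u \<in> closed_sector i\<close> by (auto simp: cusps_def Fin_in_sector(2))
    then show ?thesis
      using False bound_strict_antimono[of 1 i] assms(1) by (cases "i = 1") (auto simp: cusp_def)
  qed (use assms \<open>u \<in> closed_sector i\<close> in \<open>simp add: Infty_in_sector(2)\<close>)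
  then show "i = (if u = Infty then 7 else 1)" .
  show "branch i u = u"
    using assms(2) * branch_bound(1)[of 1] branch_bound(3)[of 1]
    by (auto simp: cusps_def cusp_def)
qed

lemma sector_subset_closed_sector: "sector i \<subseteq> closed_sector i"
  unfolding sector_def closed_sector_def by (rule image_mono) auto

lemma sector_disjoint:
  assumes "i \<in> {1..7}" "j \<in> {1..7}" "u \<in> sector i" "u \<in> sector j"
  shows "i = j"
proof -
  have main: "\<not> (u \<in> sector i \<and> u \<in> sector j)" if "i \<in> {1..7}" "j \<in> {1..7}" "i < j" for i j
  proof (cases u)
    case (Fin a)
    have "i + 1 \<in> {1..7}" "i + 1 \<le> j" "i < 7" using that by auto
    with bound_antimono[of "i + 1" j] that show ?thesis by (auto simp: Fin Fin_in_sector(1))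
  qed (use that in \<open>simp add: Infty_in_sector\<close>)
  show ?thesis using main[of i j] main[of j i] assms by (metis linorder_neqE_nat)
qed

lemma sector_index_eq:
  assumes "i \<in> {1..7}" "u \<in> sector i"
  shows "sector_index u = i"
  unfolding sector_index_def using assms sector_disjoint by blast

lemma Sigma_plus_eq: "Sigma_plus = - insert Infty inner_arc"
proof (rule set_eqI)
  fix u
  show "u \<in> Sigma_plus \<longleftrightarrow> u \<in> - insert Infty inner_arc"
  proof (cases u)
    case (Fin a)
    have "\<exists>i\<in>{1..7}. Fin a \<in> sector i" if "a \<le> cusp"
    proof -
      define i where "i = Max {i \<in> {1..7}. a \<le> bound i}"
      have fin: "finite {i \<in> {1..7::nat}. a \<le> bound i}" by simp
      have "1 \<in> {i \<in> {1..7::nat}. a \<le> bound i}" using that by (simp add: cusp_def)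
      then have "i \<in> {i \<in> {1..7}. a \<le> bound i}"
        unfolding i_def by (intro Max_in[OF fin]) blast
      then have i: "i \<in> {1..7}" "a \<le> bound i" by simp_all
      have "bound (i + 1) < a" if "i < 7"
      proof (rule ccontr)
        assume "\<not> bound (i + 1) < a"
        with that have "i + 1 \<in> {i \<in> {1..7::nat}. a \<le> bound i}" by auto
        from Max_ge[OF fin this] show False by (simp add: i_def)
      qed
      with i show ?thesis by (intro bexI[of _ i]) (auto simp: Fin_in_sector)
    qed
    moreover have "a \<le> cusp" if "i \<in> {1..7}" "Fin a \<in> sector i" for i
      using that bound_antimono[of 1 i] by (simp add: Fin_in_sector cusp_def)
    ultimately show ?thesis by (auto simp: Fin Sigma_plus_def not_less)
  qed (simp add: Sigma_plus_def Infty_in_sector)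
qed

lemma sector_index_sector:
  assumes "u \<in> Sigma_plus"
  shows "sector_index u \<in> {1..7}" "u \<in> sector (sector_index u)"
proof -
  obtain i where "i \<in> {1..7}" "u \<in> sector i" using assms unfolding Sigma_plus_def by blast
  with sector_index_eq show "sector_index u \<in> {1..7}" "u \<in> sector (sector_index u)" by auto
qed

lemma ex_closed_sector:
  assumes "u \<notin> inner_arc"
  obtains i where "i \<in> {1..7}" "branch i u \<notin> inner_arc"
proof (cases "u = Infty")
  case True
  then show ?thesis using that[of 7] branch_bound(3)[of 1] by auto
next
  case False
  with assms have "u \<in> Sigma_plus" by (simp add: Sigma_plus_eq)
  from sector_index_sector[OF this] that[of "sector_index u"] show ?thesis
    using closed_sector_iff sector_subset_closed_sector by blast
qed

section \<open>Itineraries\<close>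

primrec orbit :: "(nat \<Rightarrow> nat) \<Rightarrow> nat \<Rightarrow> rp1 \<Rightarrow> rp1" where
  "orbit s 0 u = u"
| "orbit s (Suc n) u = branch (s n) (orbit s n u)"

text \<open>Only the images are required to avoid \<open>inner_arc\<close>. For \<open>u\<close> itself
  this follows from invariance of \<open>inner_arc\<close>.\<close>

definition itinerary :: "rp1 \<Rightarrow> (nat \<Rightarrow> nat) \<Rightarrow> bool" where
  "itinerary u s \<longleftrightarrow> range s \<subseteq> {1..7} \<and> (\<forall>n. orbit s (Suc n) u \<notin> inner_arc)"

lemma orbit_add: "orbit s (m + n) u = orbit (\<lambda>k. s (m + k)) n (orbit s m u)"
  by (induction n) simp_all

lemma orbit_Suc_shift: "orbit s (Suc n) u = orbit (\<lambda>k. s (Suc k)) n (branch (s 0) u)"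
  using orbit_add[of s 1 n u] by simp

lemma itinerary_step:
  "itinerary u s \<longleftrightarrow> s 0 \<in> {1..7} \<and> branch (s 0) u \<notin> inner_arc \<and>
     itinerary (branch (s 0) u) (\<lambda>n. s (Suc n))"
proof -
  have all: "(\<forall>n. P n) \<longleftrightarrow> P 0 \<and> (\<forall>n. P (Suc n))" for P :: "nat \<Rightarrow> bool"
    by (metis nat.exhaust)
  have "(\<forall>n. orbit s (Suc n) u \<notin> inner_arc) \<longleftrightarrow> branch (s 0) u \<notin> inner_arc \<and>
      (\<forall>n. orbit (\<lambda>k. s (Suc k)) (Suc n) (branch (s 0) u) \<notin> inner_arc)"
    unfolding all[of "\<lambda>n. orbit s (Suc n) u \<notin> inner_arc"]
    using orbit_Suc_shift[of s "Suc _" u] by (simp del: orbit.simps(2)) simp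
  moreover have "range s \<subseteq> {1..7} \<longleftrightarrow> s 0 \<in> {1..7} \<and> range (\<lambda>n. s (Suc n)) \<subseteq> {1..7}"
    using all[of "\<lambda>n. s n \<in> {1..7}"] unfolding image_subset_iff by simp
  ultimately show ?thesis unfolding itinerary_def by blast
qed

lemma itinerary_drop:
  "itinerary u s \<Longrightarrow> itinerary (orbit s n u) (\<lambda>k. s (n + k))"
  unfolding itinerary_def orbit_add[symmetric] add_Suc_right[symmetric] by auto

lemma itinerary_const_cusp:
  "itinerary Infty (\<lambda>_. 7)" "itinerary (Fin cusp) (\<lambda>_. 1)"
proof -
  have "orbit (\<lambda>_. 7) n Infty = Infty" "orbit (\<lambda>_. 1) n (Fin cusp) = Fin cusp" for n
    using branch_bound(1)[of 1] branch_bound(3)[of 1]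
    by (induction n) (simp_all add: cusp_def)
  then show "itinerary Infty (\<lambda>_. 7)" "itinerary (Fin cusp) (\<lambda>_. 1)"
    unfolding itinerary_def by (auto simp del: orbit.simps)
qed

section \<open>A sequence is an itinerary of at most one point\<close>

text \<open>The absolute value of the cotangent of the angle between the two lines with inverse slopes
  \<open>u\<close> and \<open>w\<close>.\<close>

fun cot_gap :: "rp1 \<Rightarrow> rp1 \<Rightarrow> real" where
  "cot_gap (Fin u) (Fin w) = \<bar>1 + u * w\<bar> / \<bar>u - w\<bar>"
| "cot_gap (Fin u) Infty = \<bar>u\<bar>"
| "cot_gap Infty (Fin w) = \<bar>w\<bar>"
| "cot_gap Infty Infty = 0"

lemma cot_gap_nonneg: "cot_gap u w \<ge> 0"
  by (cases u; cases w) simp_all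

lemma cot_gap_commute: "cot_gap u w = cot_gap w u"
  by (cases u; cases w) (simp_all add: mult.commute abs_minus_commute)

text \<open>Both sides are \<open>0\<close> when the two lines coincide, by division by zero.\<close>

lemma cot_gap_proj:
  assumes "x \<noteq> 0" "y \<noteq> 0"
  shows "cot_gap (proj x) (proj y) = \<bar>x \<bullet> y\<bar> / \<bar>x$1 * y$2 - x$2 * y$1\<bar>"
proof -
  have nz: "x$2 = 0 \<Longrightarrow> x$1 \<noteq> 0" "y$2 = 0 \<Longrightarrow> y$1 \<noteq> 0"
    using assms by (auto simp: vec_eq_iff forall_2)
  have dot: "x \<bullet> y = x$1 * y$1 + x$2 * y$2" by (simp add: inner_vec_def sum_2)
  show ?thesis
  proof (cases "x$2 = 0 \<or> y$2 = 0")
    case True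
    then show ?thesis using nz by (auto simp: proj_def dot abs_mult)
  next
    case False
    have "1 + x$1 / x$2 * (y$1 / y$2) = (x \<bullet> y) / (x$2 * y$2)"
      "x$1 / x$2 - y$1 / y$2 = (x$1 * y$2 - x$2 * y$1) / (x$2 * y$2)"
      using False by (simp_all add: dot field_simps)
    with False show ?thesis by (simp add: proj_def abs_mult)
  qed
qed

lemma cot_gap_orthogonal:
  assumes "orthogonal_matrix A"
  shows "cot_gap (moebius A u) (moebius A w) = cot_gap u w"
proof -
  obtain x y where x: "x \<noteq> 0" "proj x = u" and y: "y \<noteq> 0" "proj y = w"
    using proj_surj[of u] proj_surj[of w] by metis
  have inv: "invertible A" using assms by (auto simp: orthogonal_matrix_def invertible_def)
  have dot: "(A *v x) \<bullet> (A *v y) = x \<bullet> y"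
  proof -
    have "(A *v x) \<bullet> (A *v y) = ((A *v x) v* A) \<bullet> y" by (simp add: dot_lmul_matrix)
    also have "(A *v x) v* A = (transpose A ** A) *v x"
      by (simp flip: transpose_matrix_vector matrix_vector_mul_assoc)
    finally show ?thesis using assms by (simp add: orthogonal_matrix)
  qed
  have "(A *v x)$1 * (A *v y)$2 - (A *v x)$2 * (A *v y)$1 = det A * (x$1 * y$2 - x$2 * y$1)"
    by (simp add: matrix_vector_mult_def sum_2 det_2 algebra_simps)
  moreover have "\<bar>det A\<bar> = 1" using det_orthogonal_matrix[OF assms] by auto
  ultimately have "\<bar>(A *v x)$1 * (A *v y)$2 - (A *v x)$2 * (A *v y)$1\<bar> = \<bar>x$1 * y$2 - x$2 * y$1\<bar>"
    by (simp add: abs_mult)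
  moreover have "A *v x \<noteq> 0" "A *v y \<noteq> 0"
    using matrix_vector_nonzero[OF inv] x y by auto
  ultimately have "cot_gap (proj (A *v x)) (proj (A *v y)) = cot_gap (proj x) (proj y)"
    using x(1) y(1) by (simp add: cot_gap_proj dot)
  then show ?thesis using x y by (simp add: proj_matrix_vector)
qed

text \<open>No sector \<open>1, \<dots>, 7\<close> contains the angle \<open>\<pi>/2\<close> in its
  interior, so finite points in one sector have inverse slopes of the same sign. The point
  \<open>\<infinity>\<close> belongs to sector \<open>7\<close>, where the inverse slopes are
  negative.\<close>

lemma common_sector_sign:
  assumes "j \<in> {1..7}" "branch j u \<notin> inner_arc" "branch j w \<notin> inner_arc"
  shows "u = Fin a \<Longrightarrow> w = Fin b \<Longrightarrow> 0 \<le> 1 + a * b"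
    "u = Fin a \<Longrightarrow> w = Infty \<Longrightarrow> a \<le> 0"
proof -
  have c: "u \<in> closed_sector j" "w \<in> closed_sector j"
    using assms closed_sector_iff by auto
  show "0 \<le> 1 + a * b" if "u = Fin a" "w = Fin b"
  proof (cases "j \<le> 3")
    case True
    then have "0 \<le> bound (j + 1)" using bound_antimono[of "j + 1" 4] assms(1) by auto
    then have "0 \<le> a" "0 \<le> b" using c True by (auto simp: that Fin_in_sector(2)[OF assms(1)])
    then show ?thesis by simp
  next
    case False
    then have "bound j \<le> 0" using bound_antimono[of 4 j] assms(1) by auto
    then have "a \<le> 0" "b \<le> 0" using c by (auto simp: that Fin_in_sector(2)[OF assms(1)])
    then show ?thesis by (simp add: mult_nonpos_nonpos)
  qed
  show "a \<le> 0" if "u = Fin a" "w = Infty"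
  proof -
    have "j = 7" using c that assms(1) by (simp add: Infty_in_sector(2))
    then have "a \<le> - 1 - sqrt 2" using c that by (simp add: Fin_in_sector(2))
    moreover have "sqrt 2 \<ge> (0::real)" by simp
    ultimately show ?thesis by linarith
  qed
qed

text \<open>For finite points \<open>a, b \<ge> c = 1 + \<surd>2\<close> the numerator \<open>1 + a
  b\<close> changes under \<open>u \<mapsto> 2c - u\<close> by \<open>- 2c (a + b - 2c)\<close>,
  and \<open>a + b - 2c\<close> is at least the denominator \<open>\<bar>a - b\<bar>\<close>.
  The common sector of the images rules out that the new numerator is negative, in which case
  the absolute value would spoil the estimate.\<close>

lemma cot_gap_flip:
  assumes z: "flip z \<notin> inner_arc" "flip z' \<notin> inner_arc" "z \<noteq> z'"
    and j: "j \<in> {1..7}" "branch j (flip z) \<notin> inner_arc" "branch j (flip z') \<notin> inner_arc"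
  shows "cot_gap (flip z) (flip z') \<le> cot_gap z z' - 2 * cusp"
proof (cases "z = Infty \<or> z' = Infty")
  case True
  have main: "cot_gap (flip (Fin a)) (flip Infty) \<le> cot_gap (Fin a) Infty - 2 * cusp"
    if "branch j (flip (Fin a)) \<notin> inner_arc" "branch j (flip Infty) \<notin> inner_arc" for a
  proof -
    have "2 * cusp - a \<le> 0" using common_sector_sign(2)[OF j(1) that] by simp
    with cusp_pos show ?thesis by simp
  qed
  consider a where "z = Fin a" "z' = Infty" | a where "z = Infty" "z' = Fin a"
    using True z(3) by (metis rp1.exhaust)
  then show ?thesis
  proof cases
    case (1 a)
    then show ?thesis using main[of a] j by simp
  next
    case (2 a)
    have "cot_gap (flip z) (flip z') = cot_gap (flip (Fin a)) (flip Infty)"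
      "cot_gap z z' = cot_gap (Fin a) Infty"
      unfolding 2 by (rule cot_gap_commute)+
    then show ?thesis using main[of a] j 2 by simp
  qed
next
  case False
  then obtain a b where ab: "z = Fin a" "z' = Fin b" by (metis rp1.exhaust)
  let ?S = "a + b - 2 * cusp"
  have ge: "cusp \<le> a" "cusp \<le> b" "a \<noteq> b" using z by (auto simp: ab)
  have id: "1 + (2 * cusp - a) * (2 * cusp - b) = 1 + a * b - 2 * cusp * ?S"
    by (simp add: algebra_simps)
  have nn: "0 \<le> 1 + (2 * cusp - a) * (2 * cusp - b)"
    using common_sector_sign(1)[OF j] by (simp add: ab)
  have "cot_gap (flip z) (flip z') = (1 + a * b - 2 * cusp * ?S) / \<bar>a - b\<bar>"
    using nn by (simp add: ab id abs_minus_commute)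
  also have "\<dots> = (1 + a * b) / \<bar>a - b\<bar> - 2 * cusp * (?S / \<bar>a - b\<bar>)"
    by (simp only: diff_divide_distrib[of "1 + a * b"] times_divide_eq_right)
  also have "\<dots> \<le> cot_gap z z' - 2 * cusp * 1"
  proof (intro diff_mono mult_left_mono)
    show "(1 + a * b) / \<bar>a - b\<bar> \<le> cot_gap z z'" by (simp add: ab divide_right_mono)
    have "\<bar>a - b\<bar> \<le> ?S" using ge by linarith
    then show "1 \<le> ?S / \<bar>a - b\<bar>" using ge(3) by (simp add: le_divide_eq)
  qed (use cusp_pos in simp)
  finally show ?thesis by simp
qed

lemma branch_inj:
  assumes "i \<in> {1..7}" "branch i u = branch i w"
  shows "u = w"
  using assms back_branch_branch(1) by metis

text \<open>Along a common itinerary of two points the nonnegative quantity \<open>cot_gap\<close> would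
  decrease by at least a fixed amount in every step.\<close>

lemma itinerary_unique_point:
  assumes "itinerary u s" "itinerary w s"
  shows "u = w"
proof (rule ccontr)
  assume "u \<noteq> w"
  have s: "s n \<in> {1..7}" for n
    using assms(1) unfolding itinerary_def by blast
  have neq: "orbit s n u \<noteq> orbit s n w" for n
    using \<open>u \<noteq> w\<close> by (induction n) (use branch_inj[OF s] in auto)
  have out: "branch (s n) (orbit s n u) \<notin> inner_arc" "branch (s n) (orbit s n w) \<notin> inner_arc" for n
    using assms unfolding itinerary_def orbit.simps by blast+
  have "cot_gap (orbit s n u) (orbit s n w) \<le> cot_gap u w - 2 * cusp * real n" for n
  proof (induction n)
    case (Suc n)
    let ?z = "moebius (nu (s n)) (orbit s n u)" and ?z' = "moebius (nu (s n)) (orbit s n w)"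
    have fl: "orbit s (Suc n) u = flip ?z" "orbit s (Suc n) w = flip ?z'"
      by (simp_all add: branch_eq[OF s])
    have "cot_gap (flip ?z) (flip ?z') \<le> cot_gap ?z ?z' - 2 * cusp"
    proof (rule cot_gap_flip)
      show "?z \<noteq> ?z'" using neq[of "Suc n"] fl by auto
      show "flip ?z \<notin> inner_arc" "flip ?z' \<notin> inner_arc"
        using out[of n] by (simp_all add: branch_eq[OF s])
      show "s (Suc n) \<in> {1..7}" by (rule s)
      show "branch (s (Suc n)) (flip ?z) \<notin> inner_arc" "branch (s (Suc n)) (flip ?z') \<notin> inner_arc"
        using out[of "Suc n"] unfolding fl by blast+
    qed
    also have "cot_gap ?z ?z' = cot_gap (orbit s n u) (orbit s n w)"
      by (rule cot_gap_orthogonal[OF orthogonal_nu[OF s]])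
    finally show ?case using Suc by (simp only: fl) (simp add: algebra_simps)
  qed simp
  moreover obtain n where "cot_gap u w < real n * (2 * cusp)"
    using reals_Archimedean3[of "2 * cusp"] cusp_pos by (metis mult_pos_pos zero_less_numeral)
  ultimately have "cot_gap (orbit s n u) (orbit s n w) < 0"
    by (smt (verit) mult.commute)
  with cot_gap_nonneg show False by (metis not_less)
qed

section \<open>Every sequence is an itinerary\<close>

text \<open>The orbit in homogeneous coordinates, on which continuity and compactness are available.\<close>

primrec lift_orbit :: "(nat \<Rightarrow> nat) \<Rightarrow> nat \<Rightarrow> real^2 \<Rightarrow> real^2" where
  "lift_orbit s 0 x = x"
| "lift_orbit s (Suc n) x = (gam ** nu (s n)) *v lift_orbit s n x"

lemma lift_orbit_proj:
  assumes "range s \<subseteq> {1..7}" "x \<noteq> 0"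
  shows "lift_orbit s n x \<noteq> 0 \<and> proj (lift_orbit s n x) = orbit s n (proj x)"
proof (induction n)
  case (Suc n)
  have "invertible (gam ** nu (s n))" using assms(1) by (intro invertible_branch) blast
  with Suc show ?case
    by (simp add: matrix_vector_nonzero proj_matrix_vector branch_def)
qed (use assms in simp)

lemma continuous_on_lift_orbit: "continuous_on UNIV (lift_orbit s n)"
proof (induction n)
  case 0
  have "lift_orbit s 0 = (\<lambda>x. x)" by auto
  then show ?case by simp
next
  case (Suc n)
  have "lift_orbit s (Suc n) = (\<lambda>x. (gam ** nu (s n)) *v lift_orbit s n x)" by auto
  moreover have "continuous_on UNIV (\<lambda>x. (gam ** nu (s n)) *v lift_orbit s n x)"
    by (rule continuous_on_compose2[OF matrix_vector_mult_linear_continuous_on Suc]) auto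
  ultimately show ?case by simp
qed

lemma ex_orbit_eq:
  assumes "range s \<subseteq> {1..7}"
  obtains u where "orbit s n u = w"
proof -
  have "\<exists>u. orbit s n u = w"
  proof (induction n arbitrary: w)
    case (Suc n)
    obtain u where "orbit s n u = back_branch (s n) w" using Suc by blast
    moreover have "s n \<in> {1..7}" using assms by blast
    ultimately show ?case using back_branch_branch(2) by (metis orbit.simps(2))
  qed simp
  then show ?thesis using that by blast
qed

lemma orbit_inner_arc_mono:
  assumes "range s \<subseteq> {1..7}" "orbit s m u \<in> inner_arc" "m \<le> n"
  shows "orbit s n u \<in> inner_arc"
  using assms(3)
proof (induction n rule: dec_induct)
  case (step n)
  moreover have "s n \<in> {1..7}" using assms(1) by blast
  ultimately show ?case using branch_inner_arc by simp
qed (use assms in simp)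

text \<open>The condition that the orbit is outside \<open>inner_arc\<close> at time \<open>n\<close> is
  closed, it can be satisfied for each \<open>n\<close> since branches are bijective, and it
  becomes stronger with \<open>n\<close> since \<open>inner_arc\<close> is invariant. The nested
  compact sets of unit vectors thus have a common point.\<close>

lemma ex_itinerary_point:
  assumes "range s \<subseteq> {1..7}"
  obtains u where "itinerary u s"
proof -
  define C where "C n = {x. lift_orbit s n x $ 2 * (lift_orbit s n x $ 1 - cusp * lift_orbit s n x $ 2) \<le> 0}
      \<inter> sphere 0 1" for n
  have C_iff: "x \<in> C n \<longleftrightarrow> norm x = 1 \<and> orbit s n (proj x) \<notin> inner_arc" for x n
  proof (cases "norm x = 1")
    case True
    then have "x \<noteq> 0" by auto
    with True show ?thesis
      using lift_orbit_proj[OF assms, of x n] proj_notin_inner_arc[of "lift_orbit s n x"]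
      by (simp add: C_def)
  qed (simp add: C_def)
  have "\<Inter> (range C) \<noteq> {}"
  proof (rule compact_nest)
    fix n
    have "closed {x. lift_orbit s n x $ 2 * (lift_orbit s n x $ 1 - cusp * lift_orbit s n x $ 2) \<le> 0}"
      by (intro closed_Collect_le continuous_intros continuous_on_lift_orbit)
    then show "compact (C n)"
      unfolding C_def by (intro closed_Int_compact) auto
    \<comment> \<open>Any point outside \<open>inner_arc\<close> may be pulled back here; \<open>Infty\<close> is the simplest.\<close>
    obtain u where u: "orbit s n u = Infty" using ex_orbit_eq[OF assms] .
    obtain x where x: "x \<noteq> 0" "proj x = u" by (rule proj_surj)
    have "proj ((1 / norm x) *\<^sub>R x) = proj x" using x(1) by (simp add: proj_def)
    with x u have "(1 / norm x) *\<^sub>R x \<in> C n" by (simp add: C_iff)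
    then show "C n \<noteq> {}" by blast
  next
    fix m n :: nat assume "m \<le> n"
    then show "C n \<subseteq> C m" using orbit_inner_arc_mono[OF assms] by (auto simp: C_iff)
  qed
  then obtain x where x: "\<And>n. x \<in> C n" by blast
  have "itinerary (proj x) s"
    using assms x[of "Suc _"] unfolding itinerary_def C_iff by blast
  then show ?thesis by (rule that)
qed

section \<open>Exceptional points\<close>

lemma cusps_forward_exceptional: "cusps \<subseteq> forward_exceptional"
  using forward_exceptional.intros(1,2) by (auto simp: cusps_def inv_slope_ends)

lemma forward_exceptional_cases:
  assumes "u \<in> forward_exceptional"
  obtains "u \<in> cusps" | i where "i \<in> {1..7}" "branch i u \<in> forward_exceptional"
  using assms by (cases rule: forward_exceptional.cases) (auto simp: cusps_def inv_slope_ends)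

text \<open>An orbit in \<open>inner_arc\<close> stays there and never reaches a cusp. Thus only words
  along sectors that contain the point matter, although \<open>forward_exceptional\<close>
  allows arbitrary ones.\<close>

lemma forward_exceptional_notin_inner_arc:
  assumes "u \<in> forward_exceptional"
  shows "u \<notin> inner_arc"
  using assms
proof (induction rule: forward_exceptional.induct)
  case (3 i u)
  then show ?case using branch_inner_arc by blast
qed (simp_all add: inv_slope_ends)

text \<open>The word that witnesses exceptionality may start with a branch other than \<open>i\<close>,
  but then both branches have the same value.\<close>

lemma branch_forward_exceptional:
  assumes "u \<in> forward_exceptional" "i \<in> {1..7}" "branch i u \<notin> inner_arc"
  shows "branch i u \<in> forward_exceptional"
  using assms(1)
proof (cases rule: forward_exceptional_cases)
  case 1
  then show ?thesis using branch_cusp(1)[OF assms(2) 1 assms(3)] assms(1) by simp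
next
  case (2 j)
  have out: "branch j u \<notin> inner_arc" by (rule forward_exceptional_notin_inner_arc[OF 2(2)])
  have "branch i u = branch j u"
  proof (cases "i = j")
    case False
    then show ?thesis by (rule branch_overlap(1)[OF assms(2) 2(1) _ assms(3) out])
  qed simp
  with 2(2) show ?thesis by (simp only:)
qed

lemma orbit_forward_exceptional:
  assumes "range s \<subseteq> {1..7}" "orbit s n u \<in> forward_exceptional"
  shows "u \<in> forward_exceptional"
  using assms(2)
proof (induction n)
  case (Suc n)
  have "s n \<in> {1..7}" using assms(1) by blast
  with Suc.prems have "orbit s n u \<in> forward_exceptional"
    unfolding orbit.simps by (rule forward_exceptional.intros(3)[rotated])
  then show ?case by (rule Suc.IH)
qed simp

text \<open>The branches \<open>7\<close> and \<open>1\<close> fix \<open>\<infinity>\<close> and \<open>1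
  + \<surd>2\<close> respectively and are parabolic there.\<close>

definition parabolic_tail :: "(nat \<Rightarrow> nat) \<Rightarrow> bool" where
  "parabolic_tail s \<longleftrightarrow> (\<exists>a\<in>{1, 7}. \<exists>n. \<forall>k\<ge>n. s k = a)"

lemma parabolic_tail_shift:
  assumes "parabolic_tail (\<lambda>n. s (Suc n))"
  shows "parabolic_tail s"
proof -
  obtain a n where a: "a \<in> {1, 7}" "\<And>k. k \<ge> n \<Longrightarrow> s (Suc k) = a"
    using assms unfolding parabolic_tail_def by blast
  have "s k = a" if "k \<ge> Suc n" for k
    using a(2)[of "k - 1"] that by simp
  with a(1) show ?thesis unfolding parabolic_tail_def by blast
qed

lemma itinerary_cusp_const:
  assumes "itinerary u s" "u \<in> cusps"
  shows "s n = (if u = Infty then 7 else 1)"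
proof -
  have s: "s n \<in> {1..7}" "branch (s n) (orbit s n u) \<notin> inner_arc" for n
    using assms(1) unfolding itinerary_def orbit.simps by blast+
  have "orbit s n u = u" for n
  proof (induction n)
    case (Suc n)
    then have "branch (s n) u = u"
      using branch_cusp(1)[OF s(1) assms(2)] s(2)[of n] by simp
    with Suc show ?case by simp
  qed simp
  then have "branch (s n) u \<notin> inner_arc" using s(2)[of n] by simp
  then show ?thesis by (rule branch_cusp(2)[OF s(1) assms(2)])
qed

text \<open>From left to right, the witnessing word agrees with the itinerary until a cusp is reached, and
  from a cusp the itinerary is constant. Conversely, when the itinerary is eventually constant,
  the orbit reaches a point that shares the itinerary of a cusp and so equals that cusp.\<close>

lemma forward_exceptional_iff_parabolic_tail:
  assumes "itinerary u s"
  shows "u \<in> forward_exceptional \<longleftrightarrow> parabolic_tail s"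
proof
  assume "u \<in> forward_exceptional"
  then show "parabolic_tail s"
    using assms
  proof (induction arbitrary: s rule: forward_exceptional.induct)
    case 1
    then show ?case using itinerary_cusp_const[of Infty s]
      by (auto simp: inv_slope_ends cusps_def parabolic_tail_def)
  next
    case 2
    then show ?case using itinerary_cusp_const[of "Fin cusp" s]
      by (auto simp: inv_slope_ends cusps_def parabolic_tail_def)
  next
    case (3 i u)
    have s: "s 0 \<in> {1..7}" "branch (s 0) u \<notin> inner_arc"
        "itinerary (branch (s 0) u) (\<lambda>n. s (Suc n))"
      using "3.prems" itinerary_step by blast+
    have out: "branch i u \<notin> inner_arc" by (rule forward_exceptional_notin_inner_arc[OF 3(2)])
    have eq: "branch i u = branch (s 0) u"
    proof (cases "i = s 0")
      case False
      then show ?thesis by (rule branch_overlap(1)[OF 3(1) s(1) _ out s(2)])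
    qed simp
    have "parabolic_tail (\<lambda>n. s (Suc n))" by (rule "3.IH") (use s(3) eq in simp)
    then show ?case by (rule parabolic_tail_shift)
  qed
next
  assume "parabolic_tail s"
  then obtain a n where a: "a \<in> {1, 7}" "\<And>k. k \<ge> n \<Longrightarrow> s k = a"
    unfolding parabolic_tail_def by blast
  have "itinerary (orbit s n u) (\<lambda>k. s (n + k))" using itinerary_drop[OF assms] .
  moreover have "(\<lambda>k. s (n + k)) = (\<lambda>_. a)" using a(2) by auto
  ultimately have "itinerary (orbit s n u) (\<lambda>_. a)" by simp
  then have "orbit s n u = (if a = 7 then Infty else Fin cusp)"
    using a(1) itinerary_unique_point[OF _ itinerary_const_cusp(1)]
      itinerary_unique_point[OF _ itinerary_const_cusp(2)] by auto
  then have "orbit s n u \<in> cusps" by (simp add: cusps_def)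
  then show "u \<in> forward_exceptional"
    using orbit_forward_exceptional[of s n u] cusps_forward_exceptional assms
    by (auto simp: itinerary_def)
qed

text \<open>Reversing a word of branches that leads from a cusp to \<open>v\<close> gives a word of
  inverse branches from \<open>v\<close> to the cusp, and \<open>back_branch_eq\<close>
  conjugates it into a word of branches at \<open>flip v\<close>.\<close>

lemma backward_exceptional_iff: "v \<in> backward_exceptional \<longleftrightarrow> flip v \<in> forward_exceptional"
proof
  assume "v \<in> backward_exceptional"
  then show "flip v \<in> forward_exceptional"
  proof (induction rule: backward_exceptional.induct)
    case (3 i v)
    have "branch (dual i) (flip (branch i v)) = flip v"
      using 3(1) back_branch_branch(1)[OF 3(1), of v] back_branch_eq[OF 3(1)] flip_flip by metis
    moreover have "dual i \<in> {1..7}" using 3(1) by simp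
    ultimately show ?case
      using 3 forward_exceptional.intros(3)[of "dual i" "flip (branch i v)"] by simp
  qed (use cusps_forward_exceptional in \<open>auto simp: cusps_def inv_slope_ends\<close>)
next
  have "u \<in> forward_exceptional \<Longrightarrow> flip u \<in> backward_exceptional" for u
  proof (induction rule: forward_exceptional.induct)
    case 1
    then show ?case using backward_exceptional.intros(1) by (simp add: inv_slope_ends)
  next
    case 2
    then show ?case using backward_exceptional.intros(2) by (simp add: inv_slope_ends)
  next
    case (3 i u)
    have d: "dual i \<in> {1..7}" using 3(1) by simp
    have "branch (dual i) (flip (branch i u)) = flip u"
      using back_branch_branch(2)[OF d, of "flip u"] back_branch_eq[OF d] by simp
    with 3 d show ?case using backward_exceptional.intros(3)[OF d] by metis
  qed
  then show "flip v \<in> forward_exceptional \<Longrightarrow> v \<in> backward_exceptional"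
    by (metis flip_flip)
qed

definition regular_points :: "rp1 set" where
  "regular_points = - inner_arc - forward_exceptional"

text \<open>In the coordinates \<open>u\<close> and \<open>flip v\<close>, the two components satisfy the
  same condition.\<close>

lemma regular_pairs_iff:
  "(u, v) \<in> regular_pairs \<longleftrightarrow> u \<in> regular_points \<and> flip v \<in> regular_points"
proof -
  have "u \<in> Sigma_plus - forward_exceptional \<longleftrightarrow> u \<in> regular_points"
    using cusps_forward_exceptional by (auto simp: Sigma_plus_eq regular_points_def cusps_def)
  moreover have "v \<in> sector 0 - backward_exceptional \<longleftrightarrow> flip v \<in> regular_points"
    using cusps_forward_exceptional flip_in_inner_arc[of "flip v"]
    by (auto simp: sector_0 regular_points_def backward_exceptional_iff cusps_def)
  ultimately show ?thesis by (simp add: regular_pairs_def)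
qed

lemma branch_regular:
  assumes "u \<in> regular_points" "i \<in> {1..7}" "branch i u \<notin> inner_arc"
  shows "branch i u \<in> regular_points"
  using assms forward_exceptional.intros(3) unfolding regular_points_def by blast

text \<open>Two admissible branches would send the point to a cusp, making it exceptional.\<close>

lemma branch_regular_unique:
  assumes "u \<in> regular_points" "i \<in> {1..7}" "branch i u \<notin> inner_arc"
    and "j \<in> {1..7}" "branch j u \<notin> inner_arc"
  shows "i = j"
proof (rule ccontr)
  assume "i \<noteq> j"
  then have "branch i u \<in> cusps" using branch_overlap(2) assms by blast
  with branch_regular[OF assms(1-3)] cusps_forward_exceptional show False
    by (auto simp: regular_points_def)
qed

lemma branch_regular_rev:
  assumes "i \<in> {1..7}" "branch i w \<in> regular_points"
  shows "w \<in> regular_points"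
  using assms branch_inner_arc branch_forward_exceptional unfolding regular_points_def by blast

lemma regular_unique_itinerary:
  assumes "u \<in> regular_points" "itinerary u s" "itinerary u s'"
  shows "s = s'"
proof
  fix n
  have s: "s n \<in> {1..7}" "s' n \<in> {1..7}" for n
    using assms unfolding itinerary_def by blast+
  have out: "branch (s n) (orbit s n u) \<notin> inner_arc" "branch (s' n) (orbit s' n u) \<notin> inner_arc" for n
    using assms unfolding itinerary_def orbit.simps by blast+
  have "orbit s n u = orbit s' n u \<and> orbit s n u \<in> regular_points \<and> s n = s' n"
  proof (induction n)
    case 0
    then show ?case using assms(1) branch_regular_unique[OF assms(1) s(1) _ s(2)] out[of 0] by simp
  next
    case (Suc n)
    then have eq: "orbit s (Suc n) u = orbit s' (Suc n) u" by simp
    have reg: "orbit s (Suc n) u \<in> regular_points"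
      using Suc branch_regular[OF _ s(1) out(1)] unfolding orbit.simps by blast
    have "s (Suc n) = s' (Suc n)"
      using branch_regular_unique[OF reg s(1) out(1) s(2)] out(2)[of "Suc n"] unfolding eq by blast
    with eq reg show ?case by blast
  qed
  then show "s n = s' n" by blast
qed

lemma ex_itinerary:
  assumes "u \<notin> inner_arc"
  obtains s where "itinerary u s"
proof -
  \<comment> \<open>The itinerary is generated greedily: outside \<open>inner_arc\<close> some branch always stays outside.\<close>
  define f where "f u = (SOME i. i \<in> {1..7} \<and> branch i u \<notin> inner_arc)" for u
  have f: "f u \<in> {1..7} \<and> branch (f u) u \<notin> inner_arc" if "u \<notin> inner_arc" for u
    unfolding f_def by (rule someI_ex) (use ex_closed_sector[OF that] in blast)
  define x where "x n = ((\<lambda>u. branch (f u) u) ^^ n) u" for n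
  have x: "x n \<notin> inner_arc" for n
    by (induction n) (use assms f in \<open>auto simp: x_def\<close>)
  have orbit: "orbit (\<lambda>n. f (x n)) n u = x n" for n
    by (induction n) (simp_all add: x_def)
  have "itinerary u (\<lambda>n. f (x n))"
    unfolding itinerary_def orbit using x f by blast
  then show ?thesis by (rule that)
qed

section \<open>Forward and backward expansions as itineraries\<close>

lemma branch_preimage_iff:
  "i \<in> {1..7} \<Longrightarrow> u \<in> branch_preimage i A \<longleftrightarrow> branch i u \<notin> inner_arc \<and> branch i u \<in> A"
  by (simp add: branch_preimage_def closed_sector_iff)

lemma forward_cylinder_iff:
  assumes "range s \<subseteq> {1..7}"
  shows "u \<in> foldr branch_preimage (map s [0..<n]) UNIV \<longleftrightarrow>
    (\<forall>k<n. orbit s (Suc k) u \<notin> inner_arc)"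
  using assms
proof (induction n arbitrary: s u)
  case (Suc n)
  have s0: "s 0 \<in> {1..7}" using Suc.prems by blast
  have sh: "range (\<lambda>k. s (Suc k)) \<subseteq> {1..7}" using Suc.prems by blast
  have "map s [0..<Suc n] = s 0 # map (\<lambda>k. s (Suc k)) [0..<n]"
    by (simp add: upt_conv_Cons map_Suc_upt[symmetric] del: upt_Suc)
  then have "u \<in> foldr branch_preimage (map s [0..<Suc n]) UNIV \<longleftrightarrow>
      branch (s 0) u \<notin> inner_arc \<and>
      (\<forall>k<n. orbit (\<lambda>k. s (Suc k)) (Suc k) (branch (s 0) u) \<notin> inner_arc)"
    by (simp only: foldr.simps o_apply branch_preimage_iff[OF s0] Suc.IH[OF sh])
  also have "\<dots> \<longleftrightarrow> branch (s 0) u \<notin> inner_arc \<and> (\<forall>k<n. orbit s (Suc (Suc k)) u \<notin> inner_arc)"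
    unfolding orbit_Suc_shift[of s "Suc _" u] ..
  also have "\<dots> \<longleftrightarrow> (\<forall>k<Suc n. orbit s (Suc k) u \<notin> inner_arc)"
    by (simp add: All_less_Suc2)
  finally show ?case .
qed simp

lemma all_less_Suc: "(\<forall>n. \<forall>k<Suc n. P k) \<longleftrightarrow> (\<forall>n. P n)"
  by blast

lemma forward_expansion_iff: "forward_expansion u s \<longleftrightarrow> itinerary u s"
proof (cases "range s \<subseteq> {1..7}")
  case True
  have "(\<Inter>k. foldr branch_preimage (map s [0..<Suc k]) UNIV) = {u. itinerary u s}"
    using True
    by (simp add: set_eq_iff itinerary_def forward_cylinder_iff all_less_Suc del: upt_Suc orbit.simps)
  then show ?thesis
    using True itinerary_unique_point by (auto simp: forward_expansion_def)
qed (auto simp: forward_expansion_def itinerary_def)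

primrec back_orbit :: "(nat \<Rightarrow> nat) \<Rightarrow> nat \<Rightarrow> rp1 \<Rightarrow> rp1" where
  "back_orbit t 0 v = v"
| "back_orbit t (Suc n) v = back_branch (t n) (back_orbit t n v)"

lemma back_orbit_Suc_shift:
  "back_orbit t (Suc n) v = back_orbit (\<lambda>k. t (Suc k)) n (back_branch (t 0) v)"
  by (induction n) simp_all

lemma back_orbit_eq:
  assumes "range t \<subseteq> {1..7}"
  shows "back_orbit t n v = flip (orbit (\<lambda>k. dual (t k)) n (flip v))"
proof (induction n)
  case (Suc n)
  have "t n \<in> {1..7}" using assms by blast
  with Suc show ?case by (simp add: back_branch_eq)
qed simp

lemma back_preimage_iff:
  assumes "i \<in> {1..7}"
  shows "v \<in> back_preimage i A \<longleftrightarrow> back_branch i v \<in> sector 0 \<and> back_branch i v \<in> A"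
proof -
  have "v \<in> branch i ` sector 0 \<longleftrightarrow> back_branch i v \<in> sector 0"
    using back_branch_branch[OF assms] by (metis imageE imageI)
  then show ?thesis by (simp add: back_preimage_def back_sector_def)
qed

lemma backward_cylinder_iff:
  assumes "range t \<subseteq> {1..7}"
  shows "v \<in> foldr back_preimage (map t [0..<Suc n]) (sector 0) \<longleftrightarrow>
    (\<forall>k<Suc n. back_orbit t (Suc k) v \<in> sector 0)"
  using assms
proof (induction n arbitrary: t v)
  case 0
  then have "t 0 \<in> {1..7}" by blast
  then show ?case by (simp add: back_preimage_iff)
next
  case (Suc n)
  have t0: "t 0 \<in> {1..7}" using Suc.prems by blast
  have sh: "range (\<lambda>k. t (Suc k)) \<subseteq> {1..7}" using Suc.prems by blast
  have "map t [0..<Suc (Suc n)] = t 0 # map (\<lambda>k. t (Suc k)) [0..<Suc n]"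
    by (simp add: upt_conv_Cons map_Suc_upt[symmetric] del: upt_Suc)
  then have "v \<in> foldr back_preimage (map t [0..<Suc (Suc n)]) (sector 0) \<longleftrightarrow>
      back_branch (t 0) v \<in> sector 0 \<and>
      (\<forall>k<Suc n. back_orbit (\<lambda>k. t (Suc k)) (Suc k) (back_branch (t 0) v) \<in> sector 0)"
    by (simp only: foldr.simps o_apply back_preimage_iff[OF t0] Suc.IH[OF sh])
  also have "\<dots> \<longleftrightarrow> back_branch (t 0) v \<in> sector 0 \<and>
      (\<forall>k<Suc n. back_orbit t (Suc (Suc k)) v \<in> sector 0)"
    unfolding back_orbit_Suc_shift[of t "Suc _" v] ..
  also have "\<dots> \<longleftrightarrow> (\<forall>k<Suc (Suc n). back_orbit t (Suc k) v \<in> sector 0)"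
    by (subst (2) All_less_Suc2) simp
  finally show ?case .
qed

lemma backward_expansion_iff:
  "backward_expansion v t \<longleftrightarrow> range t \<subseteq> {1..7} \<and> (\<forall>n. back_orbit t (Suc n) v \<in> sector 0)"
proof (cases "range t \<subseteq> {1..7}")
  case True
  then show ?thesis
    by (simp add: backward_expansion_def backward_cylinder_iff all_less_Suc
        del: upt_Suc back_orbit.simps)
qed (simp add: backward_expansion_def)

lemma backward_expansion_imp_itinerary:
  assumes "backward_expansion v t"
  shows "itinerary (flip v) (\<lambda>n. dual (t n))"
proof -
  have t: "range t \<subseteq> {1..7}" using assms by (simp add: backward_expansion_iff)
  have r: "range (\<lambda>n. dual (t n)) \<subseteq> {1..7}"
    using t dual_range by blast
  have "orbit (\<lambda>k. dual (t k)) (Suc n) (flip v) \<notin> inner_arc" for n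
  proof -
    have "flip (orbit (\<lambda>k. dual (t k)) (Suc n) (flip v)) \<in> sector 0"
      using assms back_orbit_eq[OF t] unfolding backward_expansion_iff by metis
    then show ?thesis
      using flip_in_inner_arc[of "orbit (\<lambda>k. dual (t k)) (Suc n) (flip v)"]
      by (cases "orbit (\<lambda>k. dual (t k)) (Suc n) (flip v)") (auto simp: sector_0)
  qed
  with r show ?thesis unfolding itinerary_def by blast
qed

text \<open>The converse needs regularity: the half-open sector \<open>0\<close> omits the cusp \<open>1 +
  \<surd>2\<close>, which an orbit along an itinerary may reach.\<close>

lemma itinerary_imp_backward_expansion:
  assumes "flip v \<in> regular_points" "itinerary (flip v) (\<lambda>n. dual (t n))"
  shows "backward_expansion v t"
proof -
  have r: "range (\<lambda>n. dual (t n)) \<subseteq> {1..7}" using assms by (simp add: itinerary_def)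
  then have t: "range t \<subseteq> {1..7}" using dual_range by (metis image_subset_iff)
  have "back_orbit t (Suc n) v \<in> sector 0" for n
  proof -
    let ?w = "orbit (\<lambda>k. dual (t k)) (Suc n) (flip v)"
    have "?w \<notin> forward_exceptional"
      using orbit_forward_exceptional[OF r, of "Suc n" "flip v"] assms(1)
      unfolding regular_points_def by blast
    then have "?w \<notin> cusps" using cusps_forward_exceptional by blast
    moreover have "?w \<notin> inner_arc" using assms(2) unfolding itinerary_def by blast
    ultimately have "flip ?w \<in> inner_arc" by (simp only: flip_in_inner_arc simp_thms)
    then show ?thesis by (simp only: back_orbit_eq[OF t] sector_0 insert_iff simp_thms)
  qed
  with t show ?thesis by (simp add: backward_expansion_iff del: back_orbit.simps)
qed

lemma backward_expansion_regular_iff: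
  assumes "flip v \<in> regular_points"
  shows "backward_expansion v t \<longleftrightarrow> itinerary (flip v) (\<lambda>n. dual (t n))"
  using assms backward_expansion_imp_itinerary itinerary_imp_backward_expansion by blast

section \<open>The coding\<close>

text \<open>The entry \<open>s 0\<close> moves from the forward to the backward part: as
  \<open>back_branch (s 0)\<close> undoes \<open>branch (s 0)\<close>, the backward orbit of the
  image passes through \<open>v\<close>.\<close>

lemma is_code_shift:
  assumes v: "v \<in> sector 0" and s: "is_code (u, v) s"
  shows "is_code (branch (s 0) u, branch (s 0) v) (shift s)"
proof -
  have f: "itinerary u (\<lambda>n. s (int n))" and b: "backward_expansion v (\<lambda>n. s (- 1 - int n))"
    using s by (simp_all add: is_code_def forward_expansion_iff)
  have s0: "s 0 \<in> {1..7}" and step: "itinerary (branch (s 0) u) (\<lambda>n. s (int (Suc n)))"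
    using itinerary_step[of u "\<lambda>n. s (int n)"] f by auto
  \<comment> \<open>The backward part of the shifted code: the entry \<open>s 0\<close> followed by the old backward part.\<close>
  define t where "t n = s (- int n)" for n
  have t0: "t 0 = s 0" and tS: "(\<lambda>n. t (Suc n)) = (\<lambda>n. s (- 1 - int n))"
    by (simp_all add: t_def algebra_simps)
  have all: "P n" if "P 0" "\<And>n. P (Suc n)" for P and n :: nat
    using that by (cases n) auto
  have "back_orbit t (Suc n) (branch (s 0) v) \<in> sector 0" for n
  proof (induction n rule: all)
    case 1
    then show ?case using v back_branch_branch(1)[OF s0] by (simp add: t0)
  next
    case (2 n)
    have "back_orbit t (Suc (Suc n)) (branch (s 0) v) = back_orbit (\<lambda>n. t (Suc n)) (Suc n) v"
      unfolding back_orbit_Suc_shift[of t "Suc n"] t0 back_branch_branch(1)[OF s0] ..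
    then show ?case using b unfolding tS backward_expansion_iff by metis
  qed
  moreover have "t n \<in> {1..7}" for n
  proof (induction n rule: all)
    case (2 n)
    have "t (Suc n) = s (- 1 - int n)" using tS by metis
    moreover have "s (- 1 - int n) \<in> {1..7}"
      using b unfolding backward_expansion_iff by blast
    ultimately show ?case by (simp only:)
  qed (use s0 t0 in simp)
  ultimately have "backward_expansion (branch (s 0) v) t"
    unfolding backward_expansion_iff by blast
  moreover have "t = (\<lambda>n. shift s (- 1 - int n))"
    by (simp add: t_def shift_def fun_eq_iff algebra_simps)
  ultimately show ?thesis
    using step by (simp add: is_code_def forward_expansion_iff shift_def add.commute)
qed

lemma is_code_F_hat:
  assumes "v \<in> sector 0" "is_code (u, v) s" "u \<in> sector (s 0)"
  shows "is_code (F_hat (u, v)) (shift s)"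
proof -
  have "s 0 \<in> {1..7}"
    using assms(2) itinerary_step[of u "\<lambda>n. s (int n)"]
    by (simp add: is_code_def forward_expansion_iff)
  then have "sector_index u = s 0" using assms(3) sector_index_eq by blast
  then show ?thesis using is_code_shift[OF assms(1,2)] by (simp add: F_hat_def)
qed

text \<open>If \<open>u\<close> lies in closed sector \<open>s 0\<close> but in the half-open sector
  \<open>j \<noteq> s 0\<close>, then both branches agree at \<open>u\<close>, and replacing the
  entry \<open>s 0\<close> by \<open>j\<close> gives a second code.\<close>

lemma unique_code_sector:
  assumes u: "u \<in> Sigma_plus" and s: "is_code (u, v) s" and unique: "\<And>s'. is_code (u, v) s' \<Longrightarrow> s' = s"
  shows "u \<in> sector (s 0)"
proof (rule ccontr)
  assume no: "u \<notin> sector (s 0)"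
  define j where "j = sector_index u"
  have j: "j \<in> {1..7}" "u \<in> sector j" "branch j u \<notin> inner_arc"
    using sector_index_sector[OF u] sector_subset_closed_sector[of j] closed_sector_iff[of j u]
    by (auto simp: j_def)
  with no have "j \<noteq> s 0" by auto
  have f: "itinerary u (\<lambda>n. s (int n))" and b: "backward_expansion v (\<lambda>n. s (- 1 - int n))"
    using s by (simp_all add: is_code_def forward_expansion_iff)
  have s0: "s 0 \<in> {1..7}" "branch (s 0) u \<notin> inner_arc"
      "itinerary (branch (s 0) u) (\<lambda>n. s (int (Suc n)))"
    using itinerary_step[of u "\<lambda>n. s (int n)"] f by simp_all
  have "branch j u = branch (s 0) u"
    using branch_overlap(1)[OF j(1) s0(1) \<open>j \<noteq> s 0\<close> j(3) s0(2)] .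
  with j s0 have "itinerary u (\<lambda>n. (s(0 := j)) (int n))"
    unfolding itinerary_step[of u "\<lambda>n. (s(0 := j)) (int n)"] by simp
  moreover have "(\<lambda>n. (s(0 := j)) (- 1 - int n)) = (\<lambda>n. s (- 1 - int n))" by auto
  ultimately have "is_code (u, v) (s(0 := j))"
    using b by (simp add: is_code_def forward_expansion_iff del: fun_upd_apply)
  from unique[OF this] \<open>j \<noteq> s 0\<close> show False by (metis fun_upd_same)
qed

lemma coding_domain_code:
  assumes "x \<in> coding_domain"
  shows "is_code x (coding x)" "is_code x s \<Longrightarrow> coding x = s"
proof -
  have ex: "\<exists>!s. is_code x s" using assms by (simp add: coding_domain_def)
  show "is_code x (coding x)" unfolding coding_def using ex by (rule theI')
  show "is_code x s \<Longrightarrow> coding x = s" unfolding coding_def using ex by (rule the1_equality)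
qed

lemma is_code_full_shift_space:
  assumes "is_code (u, v) s"
  shows "s \<in> full_shift_space"
proof -
  have "range (\<lambda>n. s (int n)) \<subseteq> {1..7}" "range (\<lambda>n. s (- 1 - int n)) \<subseteq> {1..7}"
    using assms by (simp_all add: is_code_def forward_expansion_def backward_expansion_def)
  then have f: "s (int n) \<in> {1..7}" "s (- 1 - int n) \<in> {1..7}" for n by blast+
  have "s i \<in> {1..7}" for i
    using f(1)[of "nat i"] f(2)[of "nat (- 1 - i)"] by (cases "i \<ge> 0") simp_all
  then show ?thesis unfolding full_shift_space_def by blast
qed

text \<open>Uniqueness of the code of \<open>x\<close> makes \<open>F_hat\<close> use the branch named by
  the code, and uniqueness of the code of \<open>F_hat x\<close> identifies it with the shifted
  one.\<close>

lemma coding_F_hat: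
  assumes "x \<in> coding_domain" "F_hat x \<in> coding_domain"
  shows "coding (F_hat x) = shift (coding x)"
proof -
  obtain u v where x: "x = (u, v)" by fastforce
  have uv: "u \<in> Sigma_plus" "v \<in> sector 0" using assms(1) by (auto simp: coding_domain_def x)
  have code: "is_code (u, v) (coding x)" "\<And>s'. is_code (u, v) s' \<Longrightarrow> s' = coding x"
    using coding_domain_code[OF assms(1)] unfolding x by blast+
  have "u \<in> sector (coding x 0)" using unique_code_sector[OF uv(1) code] .
  then have "is_code (F_hat x) (shift (coding x))"
    using is_code_F_hat[OF uv(2) code(1)] unfolding x by blast
  then show ?thesis by (rule coding_domain_code(2)[OF assms(2)])
qed

lemma is_code_regular_iff:
  assumes "(u, v) \<in> regular_pairs"
  shows "is_code (u, v) s \<longleftrightarrow>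
    itinerary u (\<lambda>n. s (int n)) \<and> itinerary (flip v) (\<lambda>n. dual (s (- 1 - int n)))"
  using assms
  by (simp add: is_code_def forward_expansion_iff regular_pairs_iff backward_expansion_regular_iff)

text \<open>The inverse of splitting a code into its forward and backward part, with the indexing of
  \<open>is_code\<close>.\<close>

definition two_sided :: "(nat \<Rightarrow> 'a) \<Rightarrow> (nat \<Rightarrow> 'a) \<Rightarrow> int \<Rightarrow> 'a" where
  "two_sided a b i = (if i \<ge> 0 then a (nat i) else b (nat (- 1 - i)))"

lemma two_sided_simps [simp]:
  "two_sided a b (int n) = a n" "two_sided a b (- 1 - int n) = b n"
  by (simp_all add: two_sided_def)

lemma two_sided_eqI:
  assumes "\<And>n. s (int n) = s' (int n)" "\<And>n. s (- 1 - int n) = s' (- 1 - int n)"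
  shows "s = s'"
proof
  fix i show "s i = s' i"
    using assms(1)[of "nat i"] assms(2)[of "nat (- 1 - i)"] by (cases "i \<ge> 0") simp_all
qed

lemma regular_pairs_subset_coding_domain: "regular_pairs \<subseteq> coding_domain"
proof
  fix x assume x: "x \<in> regular_pairs"
  obtain u v where uv: "x = (u, v)" by fastforce
  have reg: "u \<in> regular_points" "flip v \<in> regular_points"
    using x by (simp_all add: uv regular_pairs_iff)
  then have "u \<notin> inner_arc" "flip v \<notin> inner_arc" by (simp_all add: regular_points_def)
  then obtain a b where ab: "itinerary u a" "itinerary (flip v) b" using ex_itinerary by metis
  have "is_code x (two_sided a (\<lambda>n. dual (b n)))"
    using ab x by (simp add: uv is_code_regular_iff)
  moreover have "s = s'" if "is_code x s" "is_code x s'" for s s'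
  proof (rule two_sided_eqI)
    have its: "itinerary u (\<lambda>n. s (int n))" "itinerary u (\<lambda>n. s' (int n))"
      "itinerary (flip v) (\<lambda>n. dual (s (- 1 - int n)))"
      "itinerary (flip v) (\<lambda>n. dual (s' (- 1 - int n)))"
      using that x by (simp_all add: uv is_code_regular_iff)
    show "s (int n) = s' (int n)" for n
      using regular_unique_itinerary[OF reg(1) its(1,2)] by (rule fun_cong)
    show "s (- 1 - int n) = s' (- 1 - int n)" for n
      using fun_cong[OF regular_unique_itinerary[OF reg(2) its(3,4)], of n] by (metis dual_dual)
  qed
  moreover have "x \<in> Sigma_plus \<times> sector 0" using x by (auto simp: regular_pairs_def)
  ultimately show "x \<in> coding_domain" unfolding coding_domain_def by blast
qed

text \<open>In the coordinate \<open>flip v\<close> the map \<open>F_hat\<close> acts by the inverse of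
  the branch \<open>dual i\<close>, so regularity of the second component is pulled back along
  that branch.\<close>

lemma F_hat_regular:
  assumes "x \<in> regular_pairs"
  shows "F_hat x \<in> regular_pairs"
proof -
  obtain u v where uv: "x = (u, v)" by fastforce
  have reg: "u \<in> regular_points" "flip v \<in> regular_points"
    using assms by (simp_all add: uv regular_pairs_iff)
  have u: "u \<in> Sigma_plus" using assms by (simp add: uv regular_pairs_def)
  define i where "i = sector_index u"
  have i: "i \<in> {1..7}" "branch i u \<notin> inner_arc"
    using sector_index_sector[OF u] sector_subset_closed_sector[of i] closed_sector_iff[of i u]
    by (auto simp: i_def)
  have "branch (dual i) (flip (branch i v)) = flip v"
    using back_branch_branch(1)[OF i(1), of v] back_branch_eq[OF i(1)] flip_flip by metis
  then have "flip (branch i v) \<in> regular_points"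
    using branch_regular_rev[of "dual i"] i(1) reg(2) by simp
  then show ?thesis
    using branch_regular[OF reg(1) i] by (simp add: uv F_hat_def regular_pairs_iff flip: i_def)
qed

text \<open>As \<open>dual\<close> fixes \<open>1\<close> and \<open>7\<close>, the condition on the left
  tail may be read off the itinerary of \<open>flip v\<close>.\<close>

lemma regular_sequences_iff:
  "s \<in> regular_sequences \<longleftrightarrow> s \<in> full_shift_space \<and>
     \<not> parabolic_tail (\<lambda>n. s (int n)) \<and> \<not> parabolic_tail (\<lambda>n. dual (s (- 1 - int n)))"
proof -
  have d: "dual b = a \<longleftrightarrow> b = a" if "a \<in> {1, 7}" for a b
    using that by (auto simp: dual_def)
  have fw: "(\<exists>n. \<forall>i\<ge>n. s i = a) \<longleftrightarrow> (\<exists>n. \<forall>k\<ge>n. s (int k) = a)" for a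
  proof
    assume "\<exists>n. \<forall>i\<ge>n. s i = a"
    then obtain n where "\<And>i. i \<ge> n \<Longrightarrow> s i = a" by blast
    then show "\<exists>n. \<forall>k\<ge>n. s (int k) = a" by (intro exI[of _ "nat n"]) auto
  next
    assume "\<exists>n. \<forall>k\<ge>n. s (int k) = a"
    then obtain n where n: "\<And>k. k \<ge> n \<Longrightarrow> s (int k) = a" by blast
    have "s i = a" if "i \<ge> int n" for i using n[of "nat i"] that by simp
    then show "\<exists>n. \<forall>i\<ge>n. s i = a" by blast
  qed
  have bw: "(\<exists>n. \<forall>i\<le>n. s i = a) \<longleftrightarrow> (\<exists>n. \<forall>k\<ge>n. s (- 1 - int k) = a)" for a
  proof
    assume "\<exists>n. \<forall>i\<le>n. s i = a"
    then obtain n where "\<And>i. i \<le> n \<Longrightarrow> s i = a" by blast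
    then show "\<exists>n. \<forall>k\<ge>n. s (- 1 - int k) = a" by (intro exI[of _ "nat (- n)"]) auto
  next
    assume "\<exists>n. \<forall>k\<ge>n. s (- 1 - int k) = a"
    then obtain n where n: "\<And>k. k \<ge> n \<Longrightarrow> s (- 1 - int k) = a" by blast
    have "s i = a" if "i \<le> - 1 - int n" for i using n[of "nat (- 1 - i)"] that by simp
    then show "\<exists>n. \<forall>i\<le>n. s i = a" by blast
  qed
  show ?thesis
    unfolding regular_sequences_def parabolic_tail_def mem_Collect_eq fw bw
    using d by blast
qed

lemma coding_regular_sequences:
  assumes "x \<in> regular_pairs"
  shows "coding x \<in> regular_sequences"
proof -
  obtain u v where uv: "x = (u, v)" by fastforce
  have reg: "u \<in> regular_points" "flip v \<in> regular_points"
    using assms by (simp_all add: uv regular_pairs_iff)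
  have code: "is_code (u, v) (coding x)"
    using coding_domain_code(1) regular_pairs_subset_coding_domain assms by (auto simp: uv)
  then have "itinerary u (\<lambda>n. coding x (int n))" "itinerary (flip v) (\<lambda>n. dual (coding x (- 1 - int n)))"
    using assms by (simp_all add: uv is_code_regular_iff)
  with reg show ?thesis
    using is_code_full_shift_space[OF code]
    by (auto simp: regular_sequences_iff regular_points_def
        dest: forward_exceptional_iff_parabolic_tail)
qed

lemma coding_inj_on: "inj_on coding regular_pairs"
proof (rule inj_onI)
  fix x y assume xy: "x \<in> regular_pairs" "y \<in> regular_pairs" "coding x = coding y"
  obtain u v u' v' where uv: "x = (u, v)" "y = (u', v')" by fastforce
  have "is_code x (coding x)" "is_code y (coding x)"
    using coding_domain_code(1) regular_pairs_subset_coding_domain xy by (metis subsetD)+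
  then have "itinerary u (\<lambda>n. coding x (int n))" "itinerary u' (\<lambda>n. coding x (int n))"
    "itinerary (flip v) (\<lambda>n. dual (coding x (- 1 - int n)))"
    "itinerary (flip v') (\<lambda>n. dual (coding x (- 1 - int n)))"
    using xy(1,2) by (simp_all only: uv is_code_regular_iff)
  then have "u = u'" "flip v = flip v'" using itinerary_unique_point by blast+
  then show "x = y" unfolding uv by (metis flip_flip)
qed

lemma itinerary_notin_inner_arc:
  assumes "itinerary u s"
  shows "u \<notin> inner_arc"
  using assms branch_inner_arc itinerary_step by blast

lemma coding_surj_on:
  assumes "s \<in> regular_sequences"
  shows "s \<in> coding ` regular_pairs"
proof -
  have full: "range s \<subseteq> {1..7}" using assms by (simp add: regular_sequences_iff full_shift_space_def)
  have r: "range (\<lambda>n. s (int n)) \<subseteq> {1..7}" "range (\<lambda>n. dual (s (- 1 - int n))) \<subseteq> {1..7}"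
    using full dual_range by blast+
  obtain u where u: "itinerary u (\<lambda>n. s (int n))" using ex_itinerary_point[OF r(1)] .
  obtain w where w: "itinerary w (\<lambda>n. dual (s (- 1 - int n)))" using ex_itinerary_point[OF r(2)] .
  have "u \<in> regular_points" "w \<in> regular_points"
    using assms forward_exceptional_iff_parabolic_tail[OF u] itinerary_notin_inner_arc[OF u]
      forward_exceptional_iff_parabolic_tail[OF w] itinerary_notin_inner_arc[OF w]
    by (auto simp: regular_sequences_iff regular_points_def)
  then have reg: "(u, flip w) \<in> regular_pairs" by (simp add: regular_pairs_iff)
  have "is_code (u, flip w) s" using u w by (simp add: is_code_regular_iff[OF reg])
  then have "coding (u, flip w) = s"
    using coding_domain_code(2) regular_pairs_subset_coding_domain reg by blast
  with reg show ?thesis by blast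
qed

lemma bij_betw_coding: "bij_betw coding regular_pairs regular_sequences"
  unfolding bij_betw_def using coding_inj_on coding_regular_sequences coding_surj_on by blast

lemma bij_betw_shift: "bij_betw shift regular_sequences regular_sequences"
proof (rule bij_betwI[where g = "\<lambda>s i. s (i - 1)"])
  have shifted: "(\<lambda>i. s (i + c)) \<in> regular_sequences" if s: "s \<in> regular_sequences" for s and c :: int
  proof -
    have up: "\<exists>n. \<forall>i\<ge>n. s i = a" if "\<exists>n. \<forall>i\<ge>n. s (i + c) = a" for a
    proof -
      from that obtain n where "\<And>i. i \<ge> n \<Longrightarrow> s (i + c) = a" by blast
      from this[of "_ - c"] have "s i = a" if "i \<ge> n + c" for i using that by simp
      then show ?thesis by blast
    qed
    have down: "\<exists>n. \<forall>i\<le>n. s i = a" if "\<exists>n. \<forall>i\<le>n. s (i + c) = a" for a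
    proof -
      from that obtain n where "\<And>i. i \<le> n \<Longrightarrow> s (i + c) = a" by blast
      from this[of "_ - c"] have "s i = a" if "i \<le> n + c" for i using that by simp
      then show ?thesis by blast
    qed
    have "range (\<lambda>i. s (i + c)) \<subseteq> {1..7}"
      using s unfolding regular_sequences_def full_shift_space_def by blast
    moreover have "\<forall>a\<in>{1, 7}. \<not> (\<exists>n. \<forall>i\<ge>n. s i = a) \<and> \<not> (\<exists>n. \<forall>i\<le>n. s i = a)"
      using s by (simp add: regular_sequences_def)
    ultimately show ?thesis
      using up down unfolding regular_sequences_def full_shift_space_def mem_Collect_eq by meson
  qed
  show "shift \<in> regular_sequences \<rightarrow> regular_sequences"
    using shifted[of _ 1] by (auto simp: shift_def)
  show "(\<lambda>s i. s (i - 1)) \<in> regular_sequences \<rightarrow> regular_sequences"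
    using shifted[of _ "- 1"] by auto
qed (simp_all add: shift_def)

lemma bij_betw_conjugate:
  assumes h: "bij_betw h A B" and g: "bij_betw g B B" and f: "f ` A \<subseteq> A"
    and conj: "\<And>x. x \<in> A \<Longrightarrow> h (f x) = g (h x)"
  shows "bij_betw f A A"
proof -
  have "bij_betw (g \<circ> h) A B" using h g by (rule bij_betw_trans)
  then have "bij_betw (h \<circ> f) A B" using conj by (subst bij_betw_cong[of A _ "g \<circ> h"]) auto
  then show ?thesis using bij_betw_comp_iff2[OF h f] by blast
qed

theorem proposition4p2:
  shows "(\<forall>x \<in> Sigma_plus \<times> sector 0. \<forall>s.
            is_code x s \<and> fst x \<in> sector (s 0) \<longrightarrow> is_code (F_hat x) (shift s)) \<and>
         (\<forall>x \<in> coding_domain. F_hat x \<in> coding_domain \<longrightarrow>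
            coding x \<in> full_shift_space \<and> coding (F_hat x) = shift (coding x)) \<and>
         regular_pairs \<subseteq> coding_domain \<and>
         bij_betw F_hat regular_pairs regular_pairs \<and>
         bij_betw shift regular_sequences regular_sequences \<and>
         bij_betw coding regular_pairs regular_sequences \<and>
         (\<forall>x \<in> regular_pairs. coding (F_hat x) = shift (coding x))"
proof (intro conjI ballI allI impI)
  have conj: "coding (F_hat x) = shift (coding x)" if "x \<in> regular_pairs" for x
  proof (rule coding_F_hat)
    show "x \<in> coding_domain" "F_hat x \<in> coding_domain"
      using that F_hat_regular regular_pairs_subset_coding_domain by blast+
  qed
  then show "coding (F_hat x) = shift (coding x)" if "x \<in> regular_pairs" for x
    using that .
  show "bij_betw F_hat regular_pairs regular_pairs"
    using bij_betw_coding bij_betw_shift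
  proof (rule bij_betw_conjugate)
    show "F_hat ` regular_pairs \<subseteq> regular_pairs" using F_hat_regular by blast
  qed (rule conj)
  show "is_code (F_hat x) (shift s)"
    if "x \<in> Sigma_plus \<times> sector 0" "is_code x s \<and> fst x \<in> sector (s 0)" for x s
  proof -
    obtain u v where x: "x = (u, v)" by fastforce
    with that show ?thesis using is_code_F_hat[of v u s] unfolding x by simp
  qed
  show "coding x \<in> full_shift_space" if "x \<in> coding_domain" for x
  proof -
    obtain u v where x: "x = (u, v)" by fastforce
    show ?thesis
      using coding_domain_code(1)[OF that] unfolding x by (rule is_code_full_shift_space)
  qed
qed (rule coding_F_hat regular_pairs_subset_coding_domain bij_betw_shift bij_betw_coding; assumption?)+

end
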